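(* Let $n\ge1$, $x_0\in\mathbb{R}^n$, $R,\epsilon,t_1>0$, and let $m\in\left(1-\frac2n,1\right)$ with $m>0$. Let $u$ be a positive and bounded solution of $\frac{\partial u}{\partial t}=\Delta u^m$ on $(0,t_1)\times B(x_0,R+\epsilon)$, with initial value $u_0=u(0,\cdot)$, and let $v=\frac{u^{m-1}}{m-1}$. Then for every $\rho\in(0,m)$ and every $(T,x)\in(0,t_1)\times B(x_0,R)$, $$\frac{|\nabla v|^2}{(m-1)v}(T,x)\le\frac{\left\|I_{B(x_0,R+\epsilon)}\log u_0\right\|_\infty-\log u(T,x)}{m(m-\rho)T}+\frac{LM_3}{\rho(m-\rho)}+\left(\frac m2 l^{-3}+\frac32 l^{-1}\right)mM_1L^2\frac T2,$$ where $$L=\frac{8}{\epsilon^2}\left(\frac{n\epsilon}{2R+\epsilon}+\frac{8(R+\epsilon)^2}{(2R+\epsilon)^2}\right),\qquad l=\frac{-n(m-1)^2-2(m-1)}{3(m+1)},\qquad M_1=\sup_{[0,T]\times\mathcal{A}}u^{2m-2},$$ $$M_3=\sup_{[0,T]\times\mathcal{A}}\left(\rho|\log u|+(m\log u+1)^2\right)u^{m-1},\qquad \mathcal{A}=B(x_0,R+\epsilon)\setminus B(x_0,R).$$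
   Context: $B(x_0,r)$ is the closed Euclidean ball in $\mathbb{R}^n$ with centre $x_0$ and radius $r$. $I_S$ is the indicator function of the set $S$; $\|\cdot\|_\infty$ is the essential supremum norm. $\Delta$ and $\nabla$ act on the space variables. Standing assumption: $u$ is considered on $[0,t_1]\times B(x_0,R+\epsilon)$, is positive and bounded there, and is smooth there. *)

theory Defs
  imports "HOL-Analysis.Analysis" "HOL-Probability.Essential_Supremum"
begin

text \<open>
  Smoothness up to the boundary. All derivatives are taken within \<open>S\<close>; the notion is meant for
  convex sets with nonempty interior, such as a closed ball or its product with a nondegenerate
  compact interval. There the derivative within \<open>S\<close> is unique, also at boundary points, and at
  interior points it is the ordinary derivative.
\<close>

primrec C_k_within :: "nat \<Rightarrow> 'a::real_normed_vector set \<Rightarrow> ('a \<Rightarrow> 'b::real_normed_vector) \<Rightarrow> bool" where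
  "C_k_within 0 S f \<longleftrightarrow> continuous_on S f"
| "C_k_within (Suc k) S f \<longleftrightarrow>
     (\<exists>f'. (\<forall>x\<in>S. (f has_derivative f' x) (at x within S)) \<and>
           (\<forall>h. C_k_within k S (\<lambda>x. f' x h)))"

definition smooth_within :: "'a::real_normed_vector set \<Rightarrow> ('a \<Rightarrow> 'b::real_normed_vector) \<Rightarrow> bool" where
  "smooth_within S f \<longleftrightarrow> (\<forall>k. C_k_within k S f)"

definition partial_within :: "(real^'n) set \<Rightarrow> 'n \<Rightarrow> (real^'n \<Rightarrow> real) \<Rightarrow> real^'n \<Rightarrow> real" where
  "partial_within S i f x = frechet_derivative f (at x within S) (axis i 1)"

definition gradient_within :: "(real^'n) set \<Rightarrow> (real^'n \<Rightarrow> real) \<Rightarrow> real^'n \<Rightarrow> real^'n" where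
  "gradient_within S f x = (\<chi> i. partial_within S i f x)"

definition laplacian_within :: "(real^'n) set \<Rightarrow> (real^'n \<Rightarrow> real) \<Rightarrow> real^'n \<Rightarrow> real" where
  "laplacian_within S f x = (\<Sum>i\<in>UNIV. partial_within S i (partial_within S i f) x)"

text \<open>
  The essential supremum norm for Lebesgue measure. \<open>real_of_ereal\<close> sends an infinite value to 0,
  so this is meaningful only for essentially bounded measurable functions.
\<close>

definition ess_sup_norm :: "(real^'n \<Rightarrow> real) \<Rightarrow> real" where
  "ess_sup_norm f = real_of_ereal (esssup lborel (\<lambda>x. ereal \<bar>f x\<bar>))"

end

theory Submission
  imports Defs
begin

text \<open>
  Put \<open>w = ln u\<close>, \<open>a = u powr (m - 1)\<close> and \<open>q = a |\<nabla>w|\<^sup>2\<close>; the left-hand side of the theorem is \<open>q\<close>.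
  For the operator \<open>\<P> = \<partial>\<^sub>t - m a \<Delta> - 2 m\<^sup>2 a \<nabla>w \<bullet> \<nabla>\<close> one has \<open>\<P> w = - m\<^sup>2 q\<close>, and completing the
  square in the Hessian of \<open>w\<close> gives \<open>\<P> q \<le> - (3/2) m (m + 1) l q\<^sup>2\<close>. With a cutoff \<open>\<phi>\<close> that is 1 on the
  inner ball and 0 on the outer sphere, the maximum principle is applied to
  \<open>\<phi> (m (m - \<rho>) t q + w) - C1 t - C2 t\<^sup>2 / 2\<close>: on the parabolic boundary this is at most the norm
  of \<open>ln u\<^sub>0\<close>, and at an interior maximum the term \<open>- m \<rho> \<phi> q\<close> and the quadratic term in \<open>q\<close>
  absorb all derivatives of \<open>\<phi>\<close> up to the errors \<open>C1\<close> and \<open>C2 t\<close>.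
\<close>

section \<open>Smooth functions and directional derivatives\<close>

text \<open>The weight \<open>m * (m - \<rho>)\<close> is a balance. Differentiating the factor
  \<open>t\<close> produces \<open>m * (m - \<rho>) * \<phi> * q\<close>, the summand
  \<open>w\<close> contributes \<open>- m^2 * \<phi> * q\<close>, and
  \<open>- m * \<rho> * \<phi> * q\<close> survives. This remainder pays for the cross term between
  the gradients of \<phi> and \<open>w\<close>, at a price proportional to
  \<open>1 / \<rho>\<close>; what it cannot pay becomes \<open>M3\<close>. The condition
  \<open>m > 1 - 2 / n\<close> enters only as \<open>l > 0\<close>: the completed square then leaves
  a genuinely negative multiple of \<open>q^2\<close>, which has to beat every error term created by
  multiplying \<open>q\<close> by \<phi>. Two obstacles shape the analysis. The solution is smooth
  only within a closed cylinder, so second and third derivatives are taken in its interior and just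
  the first ones are extended continuously to the boundary. And the differential inequality at a
  maximum is not strict, so a small multiple of time, \<open>\<delta> * t\<close>, is subtracted: an
  interior maximum would force \<open>\<delta> \<le> 0\<close>, and \<delta> tends to 0 at the
  end.\<close>

lemma C_k_within_cong:
  assumes "\<And>x. x \<in> S \<Longrightarrow> f x = g x"
  shows "C_k_within k S f \<longleftrightarrow> C_k_within k S g"
proof (cases k)
  case 0
  then show ?thesis using continuous_on_cong[OF refl, of S f g] assms by simp
next
  case (Suc j)
  have "(f has_derivative d) (at x within S) \<longleftrightarrow> (g has_derivative d) (at x within S)"
    if "x \<in> S" for d x
    by (intro iffI; rule has_derivative_transform[OF that]) (simp_all add: assms)
  then show ?thesis using Suc by simp
qed

lemma C_k_within_subset:
  "C_k_within k S f \<Longrightarrow> T \<subseteq> S \<Longrightarrow> C_k_within k T f"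
proof (induction k arbitrary: f)
  case 0
  then show ?case using continuous_on_subset by auto
next
  case (Suc k)
  then obtain f' where f': "\<And>x. x \<in> S \<Longrightarrow> (f has_derivative f' x) (at x within S)"
    "\<And>h. C_k_within k S (\<lambda>x. f' x h)" by auto
  have "(f has_derivative f' x) (at x within T)" if "x \<in> T" for x
    using f'(1)[of x] that Suc.prems(2) has_derivative_subset by blast
  then show ?case using f'(2) Suc by auto
qed

lemma C_k_within_SucD: "C_k_within (Suc k) S f \<Longrightarrow> C_k_within k S f"
proof (induction k arbitrary: f)
  case 0
  then obtain f' where "\<And>x. x \<in> S \<Longrightarrow> (f has_derivative f' x) (at x within S)" by auto
  then show ?case
    unfolding C_k_within.simps(1) continuous_on_eq_continuous_within
    using has_derivative_continuous by blast
next
  case (Suc k)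
  then obtain f' where f': "\<And>x. x \<in> S \<Longrightarrow> (f has_derivative f' x) (at x within S)"
    "\<And>h. C_k_within (Suc k) S (\<lambda>x. f' x h)"
    unfolding C_k_within.simps(2)[of "Suc k"] by blast
  have "C_k_within k S (\<lambda>x. f' x h)" for h by (rule Suc.IH[OF f'(2)])
  then show ?case unfolding C_k_within.simps(2) using f'(1) by blast
qed

lemma C_k_within_const: "C_k_within k S (\<lambda>_. c)"
proof (induction k arbitrary: c)
  case (Suc k)
  show ?case using Suc by (auto intro!: exI[of _ "\<lambda>_ _. 0"])
qed simp

lemma C_k_within_add:
  "C_k_within k S f \<Longrightarrow> C_k_within k S g \<Longrightarrow> C_k_within k S (\<lambda>x. f x + g x)"
proof (induction k arbitrary: f g)
  case 0
  then show ?case by (simp add: continuous_on_add)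
next
  case (Suc k)
  from Suc.prems(1) obtain f' where f':
    "\<And>x. x \<in> S \<Longrightarrow> (f has_derivative f' x) (at x within S)" "\<And>h. C_k_within k S (\<lambda>x. f' x h)"
    by auto
  from Suc.prems(2) obtain g' where g':
    "\<And>x. x \<in> S \<Longrightarrow> (g has_derivative g' x) (at x within S)" "\<And>h. C_k_within k S (\<lambda>x. g' x h)"
    by auto
  show ?case using Suc.IH f' g'
    by (auto intro!: exI[of _ "\<lambda>x h. f' x h + g' x h"] has_derivative_add)
qed

lemma C_k_within_mult:
  fixes f g :: "'a::real_normed_vector \<Rightarrow> real"
  shows "C_k_within k S f \<Longrightarrow> C_k_within k S g \<Longrightarrow> C_k_within k S (\<lambda>x. f x * g x)"
proof (induction k arbitrary: f g)
  case 0
  then show ?case by (simp add: continuous_on_mult)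
next
  case (Suc k)
  note fg = C_k_within_SucD[OF Suc.prems(1)] C_k_within_SucD[OF Suc.prems(2)]
  from Suc.prems(1) obtain f' where f':
    "\<And>x. x \<in> S \<Longrightarrow> (f has_derivative f' x) (at x within S)" "\<And>h. C_k_within k S (\<lambda>x. f' x h)"
    by auto
  from Suc.prems(2) obtain g' where g':
    "\<And>x. x \<in> S \<Longrightarrow> (g has_derivative g' x) (at x within S)" "\<And>h. C_k_within k S (\<lambda>x. g' x h)"
    by auto
  note * = f' g'
  have "C_k_within k S (\<lambda>x. f x * g' x h + f' x h * g x)" for h
    by (intro C_k_within_add Suc.IH fg *)
  then show ?case using *
    by (auto intro!: exI[of _ "\<lambda>x h. f x * g' x h + f' x h * g x"] has_derivative_mult)
qed

lemma C_k_within_inverse: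
  fixes f :: "'a::real_normed_vector \<Rightarrow> real"
  assumes "\<And>x. x \<in> S \<Longrightarrow> f x \<noteq> 0"
  shows "C_k_within k S f \<Longrightarrow> C_k_within k S (\<lambda>x. inverse (f x))"
proof (induction k)
  case 0
  then show ?case using assms by (auto intro!: continuous_on_inverse)
next
  case (Suc k)
  note inv = Suc.IH[OF C_k_within_SucD[OF Suc.prems]]
  from Suc.prems obtain f' where *:
    "\<And>x. x \<in> S \<Longrightarrow> (f has_derivative f' x) (at x within S)" "\<And>h. C_k_within k S (\<lambda>x. f' x h)"
    by auto
  have "C_k_within k S (\<lambda>x. (- 1) * (inverse (f x) * f' x h * inverse (f x)))" for h
    by (intro C_k_within_mult C_k_within_const inv *)
  then show ?case using * assms
    by (auto intro!: exI[of _ "\<lambda>x h. - (inverse (f x) * f' x h * inverse (f x))"] has_derivative_inverse)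
qed

lemma smooth_within_ln:
  fixes f :: "'a::real_normed_vector \<Rightarrow> real"
  assumes "\<And>x. x \<in> S \<Longrightarrow> f x > 0" "smooth_within S f"
  shows "smooth_within S (\<lambda>x. ln (f x))"
  unfolding smooth_within_def
proof
  fix k
  have "C_k_within (Suc k) S f" using assms(2) by (simp only: smooth_within_def)
  then obtain f' where *:
    "\<And>x. x \<in> S \<Longrightarrow> (f has_derivative f' x) (at x within S)" "\<And>h. C_k_within k S (\<lambda>x. f' x h)"
    by auto
  have "C_k_within k S f" using assms(2) by (simp add: smooth_within_def)
  then have "C_k_within k S (\<lambda>x. inverse (f x) * f' x h)" for h
    using less_imp_neq[OF assms(1)] by (intro C_k_within_mult C_k_within_inverse *) auto
  moreover have "((\<lambda>x. ln (f x)) has_derivative (\<lambda>h. inverse (f x) * f' x h)) (at x within S)"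
    if "x \<in> S" for x
    using *(1) that assms(1)
    by (auto intro!: derivative_eq_intros simp: divide_inverse)
  ultimately have "C_k_within (Suc k) S (\<lambda>x. ln (f x))"
    by (auto intro!: exI[of _ "\<lambda>x h. inverse (f x) * f' x h"])
  then show "C_k_within k S (\<lambda>x. ln (f x))" by (rule C_k_within_SucD)
qed

section \<open>Derivatives in a fixed direction\<close>

definition dir_deriv :: "'a::real_normed_vector \<Rightarrow> ('a \<Rightarrow> real) \<Rightarrow> 'a \<Rightarrow> real" where
  "dir_deriv h f x = frechet_derivative f (at x) h"

lemma smooth_within_has_derivative:
  assumes "open S" "smooth_within S f" "x \<in> S"
  shows "(f has_derivative (\<lambda>h. dir_deriv h f x)) (at x)"
proof -
  have "C_k_within (Suc 0) S f" using assms(2) by (simp only: smooth_within_def)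
  then have "f differentiable (at x within S)" using assms(3) by (auto simp: differentiable_def)
  then have "f differentiable (at x)" using at_within_open[OF assms(3,1)] by simp
  then show ?thesis by (simp add: dir_deriv_def frechet_derivative_works)
qed

lemma smooth_within_dir_deriv:
  assumes "open S" "smooth_within S f"
  shows "smooth_within S (dir_deriv h f)"
  unfolding smooth_within_def
proof
  fix k
  have "C_k_within (Suc k) S f" using assms(2) by (simp only: smooth_within_def)
  then obtain f' where *:
    "\<And>x. x \<in> S \<Longrightarrow> (f has_derivative f' x) (at x within S)" "\<And>h. C_k_within k S (\<lambda>x. f' x h)"
    by auto
  have "dir_deriv h f x = f' x h" if "x \<in> S" for x
    using frechet_derivative_at[of f "f' x" x] *(1)[OF that] at_within_open[OF that assms(1)]
    by (simp add: dir_deriv_def)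
  then show "C_k_within k S (dir_deriv h f)"
    using *(2)[of h] C_k_within_cong[of S "dir_deriv h f" "\<lambda>x. f' x h" k] by simp
qed

lemma smooth_within_continuous: "smooth_within S f \<Longrightarrow> continuous_on S f"
  unfolding smooth_within_def using C_k_within.simps(1) by blast

text \<open>Only the restriction to a line is differentiated. Sums, products and compositions then
  follow from one-variable calculus, and the cutoff, which is merely twice differentiable, can be
  handled together with the smooth functions.\<close>

definition has_dir_deriv ::
    "('a::real_normed_vector \<Rightarrow> real) \<Rightarrow> 'a \<Rightarrow> 'a \<Rightarrow> real \<Rightarrow> bool" where
  "has_dir_deriv f h p d \<longleftrightarrow> ((\<lambda>s. f (p + s *\<^sub>R h)) has_real_derivative d) (at 0)"

lemma has_derivative_imp_has_dir_deriv:
  assumes "(f has_derivative f') (at p)"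
  shows "has_dir_deriv f h p (f' h)"
proof -
  have lin: "linear f'" using assms by (rule has_derivative_linear)
  have "((\<lambda>s. f (p + s *\<^sub>R h)) has_derivative (\<lambda>s. f' (s *\<^sub>R h))) (at 0)"
    by (rule has_derivative_compose[where g = f and f = "\<lambda>s. p + s *\<^sub>R h" and s = UNIV])
       (auto intro!: derivative_eq_intros assms)
  then show ?thesis
    unfolding has_dir_deriv_def has_field_derivative_def
    by (simp only: linear_scale[OF lin] real_scaleR_def mult.commute[of _ "f' h"])
qed

lemma smooth_has_dir_deriv:
  assumes "open S" "smooth_within S f" "p \<in> S"
  shows "has_dir_deriv f h p (dir_deriv h f p)"
  using has_derivative_imp_has_dir_deriv[OF smooth_within_has_derivative[OF assms]] .

lemma has_dir_deriv_shift:
  assumes "has_dir_deriv f h (p + s *\<^sub>R h) d"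
  shows "((\<lambda>t. f (p + t *\<^sub>R h)) has_real_derivative d) (at s)"
  using assms DERIV_shift[of "\<lambda>t. f (p + t *\<^sub>R h)" d 0 s]
  by (simp add: has_dir_deriv_def algebra_simps)

lemma has_dir_deriv_unique: "has_dir_deriv f h p d \<Longrightarrow> has_dir_deriv f h p e \<Longrightarrow> d = e"
  unfolding has_dir_deriv_def using DERIV_unique by blast

lemma eventually_line_in_open:
  fixes p h :: "'a::real_normed_vector"
  assumes "open S" "p \<in> S"
  shows "eventually (\<lambda>s. p + s *\<^sub>R h \<in> S) (nhds 0)"
proof -
  have "((\<lambda>s. p + s *\<^sub>R h) \<longlongrightarrow> p + 0 *\<^sub>R h) (nhds 0)"
    by (intro tendsto_intros filterlim_ident)
  then show ?thesis using assms by (auto dest: topological_tendstoD)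
qed

lemma has_dir_deriv_cong:
  assumes "open S" "p \<in> S" "\<And>x. x \<in> S \<Longrightarrow> f x = g x"
  shows "has_dir_deriv f h p d \<longleftrightarrow> has_dir_deriv g h p d"
  unfolding has_dir_deriv_def
  by (intro DERIV_cong_ev eventually_mono[OF eventually_line_in_open[OF assms(1,2), of h]])
     (auto simp: assms(3))

lemma has_dir_deriv_const: "has_dir_deriv (\<lambda>_. c) h p 0"
  by (simp add: has_dir_deriv_def)

lemma has_dir_deriv_add:
  "has_dir_deriv f h p d \<Longrightarrow> has_dir_deriv g h p e \<Longrightarrow> has_dir_deriv (\<lambda>x. f x + g x) h p (d + e)"
  unfolding has_dir_deriv_def by (rule DERIV_add)

lemma has_dir_deriv_diff:
  "has_dir_deriv f h p d \<Longrightarrow> has_dir_deriv g h p e \<Longrightarrow> has_dir_deriv (\<lambda>x. f x - g x) h p (d - e)"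
  unfolding has_dir_deriv_def by (rule DERIV_diff)

lemma has_dir_deriv_mult:
  "has_dir_deriv f h p d \<Longrightarrow> has_dir_deriv g h p e \<Longrightarrow>
    has_dir_deriv (\<lambda>x. f x * g x) h p (d * g p + f p * e)"
  unfolding has_dir_deriv_def by (drule (1) DERIV_mult) (simp add: algebra_simps)

lemma has_dir_deriv_chain:
  "(F has_real_derivative D) (at (f p)) \<Longrightarrow> has_dir_deriv f h p d \<Longrightarrow>
    has_dir_deriv (\<lambda>x. F (f x)) h p (D * d)"
  unfolding has_dir_deriv_def by (rule DERIV_chain2) auto

lemma has_dir_deriv_sum:
  "(\<And>i. i \<in> I \<Longrightarrow> has_dir_deriv (f i) h p (d i)) \<Longrightarrow>
    has_dir_deriv (\<lambda>x. \<Sum>i\<in>I. f i x) h p (\<Sum>i\<in>I. d i)"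
  unfolding has_dir_deriv_def by (rule DERIV_sum)

section \<open>Necessary conditions at a maximum\<close>

lemma second_derivative_test:
  fixes g g1 :: "real \<Rightarrow> real"
  assumes max: "eventually (\<lambda>s. g s \<le> g 0) (nhds 0)"
    and g1: "eventually (\<lambda>s. (g has_real_derivative g1 s) (at s)) (nhds 0)"
    and g2: "(g1 has_real_derivative d) (at 0)"
  shows "g1 0 = 0 \<and> d \<le> 0"
proof -
  obtain e where e: "e > 0" "\<And>s. \<bar>s\<bar> < e \<Longrightarrow> g s \<le> g 0"
    "\<And>s. \<bar>s\<bar> < e \<Longrightarrow> (g has_real_derivative g1 s) (at s)"
    using eventually_conj[OF max g1] unfolding eventually_nhds_metric by (auto simp: dist_real_def)
  have 0: "g1 0 = 0"
    using DERIV_local_max[OF e(3)[of 0] e(1)] e by auto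
  moreover have "d \<le> 0"
  proof (rule ccontr)
    assume "\<not> d \<le> 0"
    then obtain \<delta> where \<delta>: "\<delta> > 0" "\<And>s. 0 < s \<Longrightarrow> s < \<delta> \<Longrightarrow> g1 0 < g1 s"
      using has_real_derivative_pos_inc_right[OF g2] by auto
    define s where "s = min e \<delta> / 2"
    have s: "0 < s" "s < e" "s < \<delta>" using e(1) \<delta>(1) by (auto simp: s_def)
    \<comment> \<open>A positive second derivative makes \<open>g1\<close> positive just to the
      right of 0, so by the mean value theorem \<open>g\<close> would exceed its maximal
      value.\<close>
    have "\<exists>z>0. z < s \<and> g s - g 0 = (s - 0) * g1 z"
      using s by (intro MVT2) (auto intro!: e(3))
    then show False using s \<delta>(2) e(2)[of s] 0
      by (auto simp: zero_less_mult_iff) (smt (verit) mult_pos_pos)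
  qed
  ultimately show ?thesis by simp
qed

lemma has_dir_deriv_second_test:
  assumes "open S" "p \<in> S"
    and max: "eventually (\<lambda>s. f (p + s *\<^sub>R h) \<le> f p) (nhds 0)"
    and f1: "\<And>x. x \<in> S \<Longrightarrow> has_dir_deriv f h x (f1 x)"
    and f2: "has_dir_deriv f1 h p d"
  shows "f1 p = 0 \<and> d \<le> 0"
proof -
  have "eventually (\<lambda>s. ((\<lambda>t. f (p + t *\<^sub>R h)) has_real_derivative f1 (p + s *\<^sub>R h)) (at s)) (nhds 0)"
    using eventually_line_in_open[OF assms(1,2)]
    by eventually_elim (auto intro!: has_dir_deriv_shift f1)
  from second_derivative_test[OF _ this f2[unfolded has_dir_deriv_def]] max
  show ?thesis by simp
qed

text \<open>One-sided on purpose: in the time direction the maximum may sit at the terminal time,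
  where only earlier times are available for comparison.\<close>

lemma has_dir_deriv_nonneg_at_left_max:
  assumes "has_dir_deriv f h p d" "eventually (\<lambda>s. f (p + s *\<^sub>R h) \<le> f p) (at_left 0)"
  shows "d \<ge> 0"
proof (rule ccontr)
  assume "\<not> d \<ge> 0"
  then obtain \<delta> where "\<delta> > 0" "\<And>s. 0 < s \<Longrightarrow> s < \<delta> \<Longrightarrow> f p < f (p + (0 - s) *\<^sub>R h)"
    using has_real_derivative_neg_dec_left[OF assms(1)[unfolded has_dir_deriv_def]] by auto
  moreover obtain b where b: "b < 0" "\<And>s. b < s \<Longrightarrow> s < 0 \<Longrightarrow> f (p + s *\<^sub>R h) \<le> f p"
    using assms(2) by (auto simp: eventually_at_left_field)
  moreover define s where "s = min (- b) \<delta> / 2"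
  ultimately have "0 < s" "s < \<delta>" "b < - s" "f p < f (p + (0 - s) *\<^sub>R h)" by auto
  with b(2)[of "- s"] show False by simp
qed

section \<open>Symmetry of mixed second derivatives\<close>

lemma mixed_difference_mvt:
  fixes f :: "'a::real_normed_vector \<Rightarrow> real"
  assumes "open S" "smooth_within S f" "t > 0"
    and box: "\<And>a b. 0 \<le> a \<Longrightarrow> a \<le> t \<Longrightarrow> 0 \<le> b \<Longrightarrow> b \<le> t \<Longrightarrow> p + a *\<^sub>R h + b *\<^sub>R k \<in> S"
  obtains a b where "0 < a" "a < t" "0 < b" "b < t"
    "f (p + t *\<^sub>R h + t *\<^sub>R k) - f (p + t *\<^sub>R h) - f (p + t *\<^sub>R k) + f p
      = t\<^sup>2 * dir_deriv k (dir_deriv h f) (p + a *\<^sub>R h + b *\<^sub>R k)"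
proof -
  \<comment> \<open>The second difference is the increment of \<open>g\<close> over
    \<open>[0, t]\<close>, and the derivative of \<open>g\<close> is in turn an increment of
    \<open>dir_deriv h f\<close> in direction \<open>k\<close>; the mean value theorem is used once
    for each.\<close>
  define g where "g = (\<lambda>s. f ((p + t *\<^sub>R k) + s *\<^sub>R h) - f (p + s *\<^sub>R h))"
  have pS: "p + s *\<^sub>R h \<in> S" "p + t *\<^sub>R k + s *\<^sub>R h \<in> S" if "0 \<le> s" "s \<le> t" for s
    using box[of s 0] box[of s t] that assms(3) by (auto simp: algebra_simps)
  have "(g has_real_derivative (dir_deriv h f (p + t *\<^sub>R k + s *\<^sub>R h) - dir_deriv h f (p + s *\<^sub>R h)))
      (at s)" if "0 \<le> s" "s \<le> t" for s
    unfolding g_def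
    by (intro DERIV_diff has_dir_deriv_shift smooth_has_dir_deriv[OF assms(1,2)] pS that)
  then obtain a where a: "0 < a" "a < t" "g t - g 0 = t *
      (dir_deriv h f (p + t *\<^sub>R k + a *\<^sub>R h) - dir_deriv h f (p + a *\<^sub>R h))"
    using MVT2[OF assms(3), of g "\<lambda>s. dir_deriv h f (p + t *\<^sub>R k + s *\<^sub>R h) - dir_deriv h f (p + s *\<^sub>R h)"]
    by auto
  define q where "q = p + a *\<^sub>R h"
  have "((\<lambda>s. dir_deriv h f (q + s *\<^sub>R k)) has_real_derivative
      dir_deriv k (dir_deriv h f) (q + s *\<^sub>R k)) (at s)" if "0 \<le> s" "s \<le> t" for s
    using box[of a s] a that unfolding q_def
    by (intro has_dir_deriv_shift smooth_has_dir_deriv[OF assms(1)] smooth_within_dir_deriv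
        assms(1,2)) auto
  then obtain b where b: "0 < b" "b < t" "dir_deriv h f (q + t *\<^sub>R k) - dir_deriv h f (q + 0 *\<^sub>R k)
      = t * dir_deriv k (dir_deriv h f) (q + b *\<^sub>R k)"
    using MVT2[OF assms(3), of "\<lambda>s. dir_deriv h f (q + s *\<^sub>R k)"
        "\<lambda>s. dir_deriv k (dir_deriv h f) (q + s *\<^sub>R k)"] by auto
  show ?thesis
    by (rule that[OF a(1,2) b(1,2)])
       (use a(3) b(3) in \<open>simp add: g_def q_def power2_eq_square algebra_simps\<close>)
qed

text \<open>The second difference over the parallelogram spanned by \<open>t h\<close> and
  \<open>t k\<close> is symmetric in \<open>h\<close> and \<open>k\<close>. Divided by
  \<open>t^2\<close> it converges to either mixed derivative, since these are continuous.\<close>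

lemma dir_deriv_commute:
  fixes f :: "'a::real_normed_vector \<Rightarrow> real"
  assumes "open S" "smooth_within S f" "p \<in> S"
  shows "dir_deriv k (dir_deriv h f) p = dir_deriv h (dir_deriv k f) p"
proof -
  have approx: "\<exists>\<delta>>0. \<forall>t. 0 < t \<and> t < \<delta> \<longrightarrow>
      \<bar>(f (p + t *\<^sub>R h + t *\<^sub>R k) - f (p + t *\<^sub>R h) - f (p + t *\<^sub>R k) + f p) / t\<^sup>2
        - dir_deriv k (dir_deriv h f) p\<bar> < e" if "e > 0" for e h k
  proof -
    let ?G = "dir_deriv k (dir_deriv h f)"
    have "smooth_within S ?G" by (intro smooth_within_dir_deriv assms)
    then have "continuous_on S ?G" by (rule smooth_within_continuous)
    then have "isCont ?G p" using assms continuous_on_eq_continuous_at by blast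
    then have "(?G \<longlongrightarrow> ?G p) (nhds p)" by (simp add: continuous_at tendsto_nhds_iff isCont_def)
    then have "eventually (\<lambda>x. dist (?G x) (?G p) < e) (nhds p)"
      using that by (rule tendstoD)
    moreover have "eventually (\<lambda>x. x \<in> S) (nhds p)" using assms by (simp add: eventually_nhds_in_open)
    ultimately have "eventually (\<lambda>x. x \<in> S \<and> dist (?G x) (?G p) < e) (nhds p)"
      by eventually_elim simp
    then obtain d where d: "d > 0" "\<And>x. dist x p < d \<Longrightarrow> x \<in> S \<and> dist (?G x) (?G p) < e"
      unfolding eventually_nhds_metric by auto
    define \<delta> where "\<delta> = d / (norm h + norm k + 1)"
    have \<delta>: "\<delta> > 0" using d(1) by (auto simp: \<delta>_def intro!: divide_pos_pos add_nonneg_pos)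
    have near: "dist (p + a *\<^sub>R h + b *\<^sub>R k) p < d"
      if "0 \<le> a" "a \<le> t" "0 \<le> b" "b \<le> t" "t < \<delta>" for a b t
    proof -
      have "dist (p + a *\<^sub>R h + b *\<^sub>R k) p = norm (a *\<^sub>R h + b *\<^sub>R k)"
        by (simp add: dist_norm add.assoc)
      also have "\<dots> \<le> a * norm h + b * norm k"
        using norm_triangle_ineq[of "a *\<^sub>R h" "b *\<^sub>R k"] that by simp
      also have "\<dots> \<le> t * norm h + t * norm k"
        using that by (intro add_mono mult_right_mono) auto
      also have "\<dots> \<le> t * (norm h + norm k + 1)" using that by (simp add: algebra_simps)
      also have "\<dots> < \<delta> * (norm h + norm k + 1)"
        using that by (intro mult_strict_right_mono add_nonneg_pos) auto
      also have "\<dots> = d" using add_nonneg_pos[of "norm h + norm k" 1] by (simp add: \<delta>_def)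
      finally show ?thesis .
    qed
    have "\<bar>(f (p + t *\<^sub>R h + t *\<^sub>R k) - f (p + t *\<^sub>R h) - f (p + t *\<^sub>R k) + f p) / t\<^sup>2 - ?G p\<bar> < e"
      if t: "0 < t" "t < \<delta>" for t
    proof -
      obtain a b where ab: "0 < a" "a < t" "0 < b" "b < t"
        "f (p + t *\<^sub>R h + t *\<^sub>R k) - f (p + t *\<^sub>R h) - f (p + t *\<^sub>R k) + f p
          = t\<^sup>2 * ?G (p + a *\<^sub>R h + b *\<^sub>R k)"
        using mixed_difference_mvt[OF assms(1,2) t(1), of p h k] d(2) near t(2) by metis
      have "dist (?G (p + a *\<^sub>R h + b *\<^sub>R k)) (?G p) < e"
        using d(2) near[of a t b] ab t by auto
      then show ?thesis using ab(5) t by (simp add: dist_real_def)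
    qed
    then show ?thesis using \<delta> by blast
  qed
  show ?thesis
  proof (rule ccontr)
    assume ne: "dir_deriv k (dir_deriv h f) p \<noteq> dir_deriv h (dir_deriv k f) p"
    define e where "e = \<bar>dir_deriv k (dir_deriv h f) p - dir_deriv h (dir_deriv k f) p\<bar> / 2"
    have "e > 0" using ne by (simp add: e_def)
    obtain \<delta>1 \<delta>2 where d: "\<delta>1 > 0" "\<delta>2 > 0"
      "\<And>t. 0 < t \<Longrightarrow> t < \<delta>1 \<Longrightarrow>
        \<bar>(f (p + t *\<^sub>R h + t *\<^sub>R k) - f (p + t *\<^sub>R h) - f (p + t *\<^sub>R k) + f p) / t\<^sup>2
        - dir_deriv k (dir_deriv h f) p\<bar> < e"
      "\<And>t. 0 < t \<Longrightarrow> t < \<delta>2 \<Longrightarrow>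
        \<bar>(f (p + t *\<^sub>R k + t *\<^sub>R h) - f (p + t *\<^sub>R k) - f (p + t *\<^sub>R h) + f p) / t\<^sup>2
        - dir_deriv h (dir_deriv k f) p\<bar> < e"
      using approx[OF \<open>e > 0\<close>, of h k] approx[OF \<open>e > 0\<close>, of k h] by metis
    define t where "t = min \<delta>1 \<delta>2 / 2"
    have t: "0 < t" "t < \<delta>1" "t < \<delta>2" using d by (auto simp: t_def)
    have swap: "f (p + t *\<^sub>R k + t *\<^sub>R h) - f (p + t *\<^sub>R k) - f (p + t *\<^sub>R h) + f p
      = f (p + t *\<^sub>R h + t *\<^sub>R k) - f (p + t *\<^sub>R h) - f (p + t *\<^sub>R k) + f p"
      by (simp add: algebra_simps)
    have "\<bar>a - x\<bar> < \<bar>x - y\<bar> / 2 \<Longrightarrow> \<bar>a - y\<bar> < \<bar>x - y\<bar> / 2 \<Longrightarrow> False" for a x y :: real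
      by (smt (verit) field_sum_of_halves)
    then show False using d(3)[OF t(1,2)] d(4)[OF t(1,3)] unfolding swap e_def by blast
  qed
qed

lemma has_dir_deriv_eq: "has_dir_deriv f h p d \<Longrightarrow> d = e \<Longrightarrow> has_dir_deriv f h p e"
  by simp

lemma has_dir_deriv_cmult: "has_dir_deriv f h p d \<Longrightarrow> has_dir_deriv (\<lambda>x. c * f x) h p (c * d)"
  using has_dir_deriv_mult[OF has_dir_deriv_const[of c h p]] by fastforce

lemma has_dir_deriv_power2:
  "has_dir_deriv f h p d \<Longrightarrow> has_dir_deriv (\<lambda>x. (f x)\<^sup>2) h p (2 * (f p * d))"
  unfolding power2_eq_square by (rule has_dir_deriv_eq[OF has_dir_deriv_mult]) auto

lemma has_dir_deriv_exp:
  "has_dir_deriv f h p d \<Longrightarrow> has_dir_deriv (\<lambda>x. exp (f x)) h p (exp (f p) * d)"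
  by (rule has_dir_deriv_chain[where F = exp]) (rule DERIV_exp)

lemma has_dir_deriv_fst: "has_dir_deriv fst h p (fst h)"
  unfolding has_dir_deriv_def by (auto intro!: derivative_eq_intros)

lemma has_dir_deriv_snd:
  "has_dir_deriv f (snd h) (snd p) d \<Longrightarrow> has_dir_deriv (\<lambda>p. f (snd p)) h p d"
  unfolding has_dir_deriv_def by simp

lemma dir_deriv_cong:
  fixes f g :: "'a::real_normed_vector \<Rightarrow> real"
  assumes "open S" "smooth_within S f" "smooth_within S g" "p \<in> S" "\<And>x. x \<in> S \<Longrightarrow> f x = g x"
  shows "dir_deriv h f p = dir_deriv h g p"
proof (rule has_dir_deriv_unique)
  show "has_dir_deriv f h p (dir_deriv h f p)" by (rule smooth_has_dir_deriv[OF assms(1,2,4)])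
  show "has_dir_deriv f h p (dir_deriv h g p)"
    using smooth_has_dir_deriv[OF assms(1,3,4)] has_dir_deriv_cong[OF assms(1,4,5)] by simp
qed

section \<open>The pointwise inequality\<close>

text \<open>The factors 3 and 16/3 leave room for a cutoff steeper than the affine one, whose slope 1 would
  give \<open>b\<^sup>2 \<le> L\<close>.\<close>

lemma young_absorption:
  fixes m l L A b X :: real
  assumes "0 < m" "m < 1" "0 < l" "9 * l\<^sup>2 \<le> 1 - m" "0 \<le> L" "A \<le> 3 * L" "b ^ 4 \<le> 16 / 3 * L\<^sup>2"
  shows "X\<^sup>2 * A + 2 * m * X ^ 3 * b - 3 / 2 * (m + 1) * l * X ^ 4
    \<le> (m / 2 * (1 / l ^ 3) + 3 / 2 * (1 / l)) * L\<^sup>2"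
proof -
  have cubic: "2 * m * X ^ 3 * b \<le> 3 * m * l * X ^ 4 + m * b ^ 4 / (16 * l ^ 3)"
  proof -
    \<comment> \<open>Young's inequality \<open>4 \<beta> Y^3 \<le> 3 Y^4 + \<beta>^4\<close>, made
      visible by a factorization. The scaling is such that, after multiplication by
      \<open>m / l^3\<close>, the left side is the cubic term and the quartic cost is
      \<open>3 m l X^4\<close>.\<close>
    let ?Y = "l * X" and ?\<beta> = "b / 2"
    have "3 * ?Y ^ 4 + ?\<beta> ^ 4 - 4 * ?\<beta> * ?Y ^ 3 = (?Y - ?\<beta>)\<^sup>2 * (2 * ?Y\<^sup>2 + (?Y + ?\<beta>)\<^sup>2)"
      by (simp add: power2_eq_square power3_eq_cube power4_eq_xxxx algebra_simps)
    also have "\<dots> \<ge> 0" by (intro mult_nonneg_nonneg add_nonneg_nonneg) auto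
    finally have "0 \<le> (3 * ?Y ^ 4 + ?\<beta> ^ 4 - 4 * ?\<beta> * ?Y ^ 3) * (m / l ^ 3)"
      using assms by (intro mult_nonneg_nonneg) auto
    also have "\<dots> = 3 * m * l * X ^ 4 + m * b ^ 4 / (16 * l ^ 3) - 2 * m * X ^ 3 * b"
      using assms by (simp add: field_simps power2_eq_square power3_eq_cube power4_eq_xxxx)
    finally show ?thesis by simp
  qed
  \<comment> \<open>After the cubic term has used \<open>3 m l\<close> of the coefficient
    \<open>3/2 (m + 1) l\<close>, exactly \<open>3/2 (1 - m) l\<close> remains for the term with
    \<open>A\<close>.\<close>
  have quad: "X\<^sup>2 * A \<le> 3 / 2 * (1 - m) * l * X ^ 4 + 3 * L\<^sup>2 / (2 * (1 - m) * l)"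
  proof -
    have "0 \<le> (((1 - m) * l) * X\<^sup>2 - L)\<^sup>2 * (3 / (2 * (1 - m) * l))"
      using assms by (intro mult_nonneg_nonneg) auto
    also have "\<dots> = 3 / 2 * (1 - m) * l * X ^ 4 + 3 * L\<^sup>2 / (2 * (1 - m) * l) - X\<^sup>2 * (3 * L)"
    proof -
      have "((k * X\<^sup>2 - L)\<^sup>2) * (3 / (2 * k)) = 3 / 2 * k * X ^ 4 + 3 * L\<^sup>2 / (2 * k) - X\<^sup>2 * (3 * L)"
        if "k > 0" for k
        using that by (simp add: field_simps power2_eq_square power4_eq_xxxx)
      from this[of "(1 - m) * l"] show ?thesis using assms by (simp only: mult.assoc) auto
    qed
    finally show ?thesis using mult_left_mono[OF assms(6), of "X\<^sup>2"] by simp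
  qed
  have "m * b ^ 4 / (16 * l ^ 3) \<le> m * (16 / 3 * L\<^sup>2) / (16 * l ^ 3)"
    using assms by (intro divide_right_mono mult_left_mono) auto
  also have "\<dots> = m * L\<^sup>2 / (3 * l ^ 3)" by simp
  finally have b: "m * b ^ 4 / (16 * l ^ 3) \<le> m * L\<^sup>2 / (3 * l ^ 3)" .
  have "m * L\<^sup>2 / (3 * l ^ 3) + 3 * L\<^sup>2 / (2 * (1 - m) * l)
      \<le> (m / 2 * (1 / l ^ 3) + 3 / 2 * (1 / l)) * L\<^sup>2"
  proof -
    \<comment> \<open>The cubic term used \<open>m / (3 l^3)\<close> out of
      \<open>m / (2 l^3)\<close>. The surplus \<open>m / (6 l^3)\<close> compensates the factor
      \<open>1 / (1 - m)\<close> in the other error, and \<open>9 l^2 \<le> 1 - m\<close> is what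
      makes it sufficient.\<close>
    have "(m / 2 * (1 / l ^ 3) + 3 / 2 * (1 / l)) * L\<^sup>2 - (m * L\<^sup>2 / (3 * l ^ 3) + 3 * L\<^sup>2 / (2 * (1 - m) * l))
      = (1 - m - 9 * l\<^sup>2) * (L\<^sup>2 * m / (6 * l ^ 3 * (1 - m)))"
      using assms by (simp add: divide_simps) (simp add: algebra_simps power2_eq_square power3_eq_cube)
    also have "\<dots> \<ge> 0" using assms by (intro mult_nonneg_nonneg) auto
    finally show ?thesis by simp
  qed
  moreover have "3 / 2 * (m + 1) * l * X ^ 4 = 3 * m * l * X ^ 4 + 3 / 2 * (1 - m) * l * X ^ 4"
    by (simp add: field_simps)
  ultimately show ?thesis using cubic quad b by linarith
qed

text \<open>The expression is the squared Frobenius norm of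
  \<open>\<phi> (H - k y\<otimes>y + (k/2) |y|\<^sup>2 I) + (y\<otimes>z + z\<otimes>y) / 2\<close>.\<close>

lemma hessian_square_nonneg:
  fixes y z :: "'n::finite \<Rightarrow> real" and H :: "'n \<Rightarrow> 'n \<Rightarrow> real"
  assumes sym: "\<And>i j. H i j = H j i"
  defines "h \<equiv> \<Sum>i\<in>UNIV. (y i)\<^sup>2" and "P \<equiv> \<Sum>i\<in>UNIV. z i * y i" and "Z \<equiv> \<Sum>i\<in>UNIV. (z i)\<^sup>2"
    and "D \<equiv> \<Sum>i\<in>UNIV. H i i" and "\<sigma> \<equiv> \<Sum>i\<in>UNIV. \<Sum>j\<in>UNIV. (H i j)\<^sup>2"
    and "\<eta> \<equiv> \<Sum>j\<in>UNIV. y j * (\<Sum>i\<in>UNIV. y i * H i j)"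
    and "\<kappa> \<equiv> \<Sum>j\<in>UNIV. z j * (\<Sum>i\<in>UNIV. y i * H i j)"
  shows "0 \<le> \<phi>\<^sup>2 * \<sigma> + (h * Z + P\<^sup>2) / 2 + \<phi>\<^sup>2 * (real CARD('n) * k\<^sup>2 * h\<^sup>2 / 4) + 2 * \<phi> * \<kappa>
    - 2 * \<phi>\<^sup>2 * (k * \<eta> - k / 2 * h * D) - \<phi> * k * h * P"
proof -
  define \<delta> where "\<delta> = (\<lambda>i j::'n. of_bool (i = j) :: real)"
  \<comment> \<open>The double sum is treated as a linear functional, so that the expanded square
    can be evaluated monomial by monomial. The dimension enters through the trace of the identity
    matrix.\<close>
  define S where "S = (\<lambda>f :: 'n \<Rightarrow> 'n \<Rightarrow> real. \<Sum>i\<in>UNIV. \<Sum>j\<in>UNIV. f i j)"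
  have S_add: "S (\<lambda>i j. f i j + g i j) = S f + S g" for f g by (simp add: S_def sum.distrib)
  have S_mult: "S (\<lambda>i j. c * f i j) = c * S f" for c f by (simp add: S_def sum_distrib_left)
  have S1: "S (\<lambda>i j. (H i j)\<^sup>2) = \<sigma>" by (simp add: S_def \<sigma>_def)
  have S2: "S (\<lambda>i j. (y i * y j)\<^sup>2) = h\<^sup>2"
    by (simp add: S_def h_def power2_eq_square[of "sum _ _"] sum_product power_mult_distrib)
  have \<delta>_sum: "(\<Sum>j\<in>UNIV. \<delta> i j * f j) = f i" "(\<Sum>j\<in>UNIV. f j * \<delta> i j) = f i" for i f
    by (simp_all add: \<delta>_def of_bool_def if_distrib[of "\<lambda>x. _ * x"] if_distrib[of "\<lambda>x. x * _"] cong: if_cong)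
  have S3: "S (\<lambda>i j. \<delta> i j) = real CARD('n)" by (simp add: S_def \<delta>_def)
  have S4: "S (\<lambda>i j. (y i * z j)\<^sup>2) = h * Z"
    by (simp add: S_def h_def Z_def sum_product power_mult_distrib)
  have S5: "S (\<lambda>i j. (z i * y j)\<^sup>2) = h * Z"
    by (subst S4[symmetric], unfold S_def, subst sum.swap) (simp add: mult_ac)
  have S6: "S (\<lambda>i j. (z i * y i) * (z j * y j)) = P\<^sup>2"
    by (simp add: S_def P_def power2_eq_square sum_product)
  have S7: "S (\<lambda>i j. H i j * (y i * y j)) = \<eta>"
    unfolding S_def \<eta>_def sum_distrib_left by (subst sum.swap) (simp add: mult_ac)
  have S8: "S (\<lambda>i j. H i j * \<delta> i j) = D" by (simp add: S_def D_def \<delta>_sum)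
  have S9: "S (\<lambda>i j. H i j * (y i * z j)) = \<kappa>"
    unfolding S_def \<kappa>_def sum_distrib_left by (subst sum.swap) (simp add: mult_ac)
  have S10: "S (\<lambda>i j. H i j * (z i * y j)) = \<kappa>"
    unfolding S_def \<kappa>_def sum_distrib_left by (simp add: mult_ac sym)
  have S11: "S (\<lambda>i j. \<delta> i j * (y i * y j)) = h" by (simp add: S_def h_def \<delta>_sum power2_eq_square)
  have S12: "S (\<lambda>i j. \<delta> i j * (y i * z j)) = P" by (simp add: S_def P_def \<delta>_sum mult.commute)
  have S13: "S (\<lambda>i j. \<delta> i j * (z i * y j)) = P" by (simp add: S_def P_def \<delta>_sum)
  have S14: "S (\<lambda>i j. (y i * y i) * (y j * z j)) = h * P"
    by (simp add: S_def h_def P_def sum_product power2_eq_square mult.commute)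
  have S15: "S (\<lambda>i j. (y i * z i) * (y j * y j)) = h * P"
    by (subst S14[symmetric], unfold S_def, subst sum.swap) (simp add: mult_ac)
  let ?M = "\<lambda>i j. \<phi> * H i j - \<phi> * k * (y i * y j) + \<phi> * k / 2 * h * \<delta> i j + (1/2) * (y i * z j) + (1/2) * (z i * y j)"
  have "(?M i j)\<^sup>2 = \<phi>\<^sup>2 * (H i j)\<^sup>2 + (\<phi>\<^sup>2 * k\<^sup>2 * (y i * y j)\<^sup>2 + (\<phi>\<^sup>2 * k\<^sup>2 / 4 * h\<^sup>2 * \<delta> i j
      + (1/4 * (y i * z j)\<^sup>2 + (1/4 * (z i * y j)\<^sup>2 + (1/2 * ((z i * y i) * (z j * y j))
      + (- 2 * \<phi>\<^sup>2 * k * (H i j * (y i * y j)) + (\<phi>\<^sup>2 * k * h * (H i j * \<delta> i j)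
      + (\<phi> * (H i j * (y i * z j)) + (\<phi> * (H i j * (z i * y j))
      + (- \<phi>\<^sup>2 * k\<^sup>2 * h * (\<delta> i j * (y i * y j)) + (- \<phi> * k * ((y i * y i) * (y j * z j))
      + (- \<phi> * k * ((y i * z i) * (y j * y j)) + (\<phi> * k / 2 * h * (\<delta> i j * (y i * z j))
      + \<phi> * k / 2 * h * (\<delta> i j * (z i * y j)))))))))))))))" for i j
  proof -
    \<comment> \<open>The entries of the identity matrix equal their squares, which is how the
      square of that summand becomes linear in \<open>\<delta> i j\<close>.\<close>
    have "\<delta> i j = 0 \<or> \<delta> i j = 1" by (simp add: \<delta>_def)
    then show ?thesis by (elim disjE) (simp_all add: power2_eq_square field_simps)
  qed
  then have "S (\<lambda>i j. (?M i j)\<^sup>2) = \<phi>\<^sup>2 * \<sigma> + (\<phi>\<^sup>2 * k\<^sup>2 * h\<^sup>2 + (\<phi>\<^sup>2 * k\<^sup>2 / 4 * h\<^sup>2 * real CARD('n)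
      + (1/4 * (h * Z) + (1/4 * (h * Z) + (1/2 * P\<^sup>2
      + (- 2 * \<phi>\<^sup>2 * k * \<eta> + (\<phi>\<^sup>2 * k * h * D
      + (\<phi> * \<kappa> + (\<phi> * \<kappa>
      + (- \<phi>\<^sup>2 * k\<^sup>2 * h * h + (- \<phi> * k * (h * P)
      + (- \<phi> * k * (h * P) + (\<phi> * k / 2 * h * P
      + \<phi> * k / 2 * h * P)))))))))))))"
    by (simp only: S_add S_mult S1 S2 S3 S4 S5 S6 S7 S8 S9 S10 S11 S12 S13 S14 S15)
  moreover have "0 \<le> S (\<lambda>i j. (?M i j)\<^sup>2)" unfolding S_def by (intro sum_nonneg) auto
  ultimately show ?thesis by (simp add: field_simps power2_eq_square)
qed

text \<open>With the names of the preceding lemma and \<open>k = 1 - m\<close>, the left-hand side is \<open>(\<P> (\<phi> q)) / a\<^sup>2\<close>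
  for \<open>y = \<nabla>w\<close>, \<open>H = D\<^sup>2w\<close>, \<open>z = \<nabla>\<phi>\<close>, \<open>\<tau> = \<nabla>w \<bullet> \<nabla>\<Delta>w\<close> and \<open>\<Lambda> = \<Delta>\<phi>\<close>.\<close>

lemma localized_gradient_scalar:
  fixes m n h P Z D \<sigma> \<eta> \<kappa> \<tau> \<phi> l \<Lambda> :: real
  assumes sq: "0 \<le> \<phi>\<^sup>2 * \<sigma> + (h * Z + P\<^sup>2) / 2 + \<phi>\<^sup>2 * (n * (1 - m)\<^sup>2 * h\<^sup>2 / 4) + 2 * \<phi> * \<kappa>
      - 2 * \<phi>\<^sup>2 * ((1 - m) * \<eta> - (1 - m) / 2 * h * D) - \<phi> * (1 - m) * h * P"
    and cs: "P\<^sup>2 \<le> h * Z" and "0 < m" "0 < \<phi>"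
    and l: "l * (3 * (m + 1)) = - n * (m - 1)\<^sup>2 - 2 * (m - 1)"
  shows "\<phi> * (3 * m * (m - 1) * h * (D + m * h) + 2 * m * \<tau> + 4 * m\<^sup>2 * \<eta>)
      - m * \<phi> * ((m - 1)\<^sup>2 * h\<^sup>2 + (m - 1) * D * h + 4 * (m - 1) * \<eta> + 2 * \<sigma> + 2 * \<tau>)
      - m * h * \<Lambda> - 2 * m * ((m - 1) * h * P + 2 * \<kappa>)
      - 2 * m\<^sup>2 * (\<phi> * ((m - 1) * h\<^sup>2 + 2 * \<eta>) + h * P)
    \<le> m * (2 * h * Z / \<phi> - h * \<Lambda> - 2 * m * h * P - 3 / 2 * (m + 1) * l * \<phi> * h\<^sup>2)"
    (is "?E \<le> m * ?B")
proof -
  let ?sq = "\<phi>\<^sup>2 * \<sigma> + (h * Z + P\<^sup>2) / 2 + \<phi>\<^sup>2 * (n * (1 - m)\<^sup>2 * h\<^sup>2 / 4) + 2 * \<phi> * \<kappa>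
      - 2 * \<phi>\<^sup>2 * ((1 - m) * \<eta> - (1 - m) / 2 * h * D) - \<phi> * (1 - m) * h * P"
  have "\<phi> * ?B = 2 * h * Z + \<phi> * (- h * \<Lambda> - 2 * m * h * P - \<phi> * h\<^sup>2 / 2 * (l * (3 * (m + 1))))"
    using assms(4) by (simp add: field_simps)
  then have "m * (\<phi> * ?B) - \<phi> * ?E = m * (2 * h * Z
      + \<phi> * (- h * \<Lambda> - 2 * m * h * P - \<phi> * h\<^sup>2 / 2 * (- n * (m - 1)\<^sup>2 - 2 * (m - 1)))) - \<phi> * ?E"
    by (simp only: l)
  \<comment> \<open>The third derivatives in \<tau> cancel, because \<open>q\<close> and the
    equation contribute them with opposite signs. What remains is the completed square plus the
    Cauchy-Schwarz defect, which turns \<open>P^2\<close> into \<open>h Z\<close>.\<close>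
  also have "\<dots> = 2 * m * ?sq + m * (h * Z - P\<^sup>2)"
    by (simp add: field_simps power2_eq_square)
  also have "\<dots> \<ge> 0" using sq cs assms(3) by (intro add_nonneg_nonneg mult_nonneg_nonneg) auto
  finally have "\<phi> * ?E \<le> \<phi> * (m * ?B)" by (simp add: mult_ac)
  then show ?thesis using assms(4) by (simp only: mult_le_cancel_left_pos)
qed

text \<open>Here \<open>y = \<nabla>w\<close>, \<open>H = D\<^sup>2w\<close>, \<open>W i j = \<partial>\<^sub>j \<partial>\<^sub>j \<partial>\<^sub>i w\<close>, \<open>T = \<nabla>\<Delta>w\<close>, \<open>z = \<nabla>\<phi>\<close> and \<open>zz j = \<partial>\<^sub>j \<partial>\<^sub>j \<phi>\<close>; the
  abbreviations \<open>wt\<close>, \<open>wti\<close>, \<open>qt\<close>, \<open>qj\<close>, \<open>qjj\<close> are the derivatives of \<open>w\<close>, \<open>\<nabla>w\<close> and \<open>q = a |y|\<^sup>2\<close>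
  prescribed by the equation, and \<open>grad\<close>, \<open>hess\<close> are the first and second order conditions at a maximum.\<close>

lemma evolution_inequality:
  fixes y z zz T :: "'n::finite \<Rightarrow> real" and H W :: "'n \<Rightarrow> 'n \<Rightarrow> real"
    and m \<rho> l a w t \<phi> C1 C2 :: real
  assumes sym: "\<And>i j. H i j = H j i" and "0 < m" "\<rho> < m" "0 < \<phi>" "0 < t"
    and l: "l * (3 * (m + 1)) = - real CARD('n) * (m - 1)\<^sup>2 - 2 * (m - 1)"
    and T: "\<And>i. T i = (\<Sum>j\<in>UNIV. W i j)"
  defines "c \<equiv> m * (m - \<rho>)"
  defines "h \<equiv> \<Sum>i\<in>UNIV. (y i)\<^sup>2" and "P \<equiv> \<Sum>i\<in>UNIV. z i * y i" and "Z \<equiv> \<Sum>i\<in>UNIV. (z i)\<^sup>2"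
    and "D \<equiv> \<Sum>i\<in>UNIV. H i i" and "\<Lambda> \<equiv> \<Sum>i\<in>UNIV. zz i"
    and "Hy \<equiv> \<lambda>j. \<Sum>i\<in>UNIV. y i * H i j"
  defines "wt \<equiv> m * a * (D + m * h)"
    and "wti \<equiv> \<lambda>i. m * a * ((m - 1) * y i * (D + m * h) + (T i + 2 * m * Hy i))"
  defines "qt \<equiv> a * ((m - 1) * wt * h + 2 * (\<Sum>i\<in>UNIV. y i * wti i))"
    and "qj \<equiv> \<lambda>j. a * ((m - 1) * y j * h + 2 * Hy j)"
    and "qjj \<equiv> \<lambda>j. a * ((m - 1) * y j * ((m - 1) * y j * h + 2 * Hy j) + (m - 1) * H j j * h
      + (m - 1) * y j * (2 * Hy j) + 2 * (\<Sum>i\<in>UNIV. (H i j)\<^sup>2 + y i * W i j))"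
    and "Q \<equiv> c * t * (a * h) + w"
  assumes grad: "\<And>j. z j * Q + \<phi> * (c * t * qj j + y j) = 0"
    and hess: "\<And>j. zz j * Q + 2 * z j * (c * t * qj j + y j) + \<phi> * (c * t * qjj j + H j j) \<le> 0"
    and "0 < a"
  shows "\<phi> * (c * (a * h) + c * t * qt + wt) - C1 - C2 * t
    \<le> c * t * (a\<^sup>2 * (m * (2 * h * Z / \<phi> - h * \<Lambda> - 2 * m * h * P - 3 / 2 * (m + 1) * l * \<phi> * h\<^sup>2)))
      - m * \<rho> * \<phi> * (a * h) - m * a * w * \<Lambda> - 2 * m * a * (1 + m * w) * P - C1 - C2 * t"
proof -
  define \<sigma> \<eta> \<kappa> \<tau> where "\<sigma> = (\<Sum>i\<in>UNIV. \<Sum>j\<in>UNIV. (H i j)\<^sup>2)" and "\<eta> = (\<Sum>j\<in>UNIV. y j * Hy j)"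
    and "\<kappa> = (\<Sum>j\<in>UNIV. z j * Hy j)" and "\<tau> = (\<Sum>i\<in>UNIV. y i * T i)"
  have yw: "(\<Sum>i\<in>UNIV. y i * wti i)
      = m * a * ((m - 1) * (D + m * h) * h + (\<tau> + 2 * m * \<eta>))"
    unfolding wti_def h_def \<tau>_def \<eta>_def sum_distrib_left sum.distrib[symmetric]
    by (intro sum.cong) (auto simp: algebra_simps power2_eq_square)
  have qt: "qt = a\<^sup>2 * (3 * m * (m - 1) * h * (D + m * h) + 2 * m * \<tau> + 4 * m\<^sup>2 * \<eta>)"
    unfolding qt_def wt_def yw by (simp add: algebra_simps power2_eq_square)
  have yq: "(\<Sum>j\<in>UNIV. y j * qj j) = a * ((m - 1) * h * h + 2 * \<eta>)"
  proof -
    have "(\<Sum>j\<in>UNIV. y j * qj j) = (\<Sum>j\<in>UNIV. a * ((m - 1) * h * (y j)\<^sup>2 + 2 * (y j * Hy j)))"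
      unfolding qj_def by (intro sum.cong) (auto simp: algebra_simps power2_eq_square)
    then show ?thesis unfolding \<eta>_def
      by (simp add: sum_distrib_left[symmetric] sum.distrib h_def)
  qed
  have zq: "(\<Sum>j\<in>UNIV. z j * qj j) = a * ((m - 1) * h * P + 2 * \<kappa>)"
    unfolding qj_def P_def \<kappa>_def sum_distrib_left sum.distrib[symmetric]
    by (intro sum.cong) (auto simp: algebra_simps)
  have \<sigma>': "\<sigma> = (\<Sum>j\<in>UNIV. \<Sum>i\<in>UNIV. (H i j)\<^sup>2)" unfolding \<sigma>_def by (rule sum.swap)
  have \<tau>': "\<tau> = (\<Sum>j\<in>UNIV. \<Sum>i\<in>UNIV. y i * W i j)"
    unfolding \<tau>_def T sum_distrib_left by (rule sum.swap)
  have qjj: "(\<Sum>j\<in>UNIV. qjj j) = a * ((m - 1)\<^sup>2 * h\<^sup>2 + (m - 1) * D * h + 4 * (m - 1) * \<eta> + 2 * \<sigma> + 2 * \<tau>)"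
  proof -
    have "qjj j = a * ((m - 1)\<^sup>2 * h * (y j)\<^sup>2 + (m - 1) * h * H j j + 4 * (m - 1) * (y j * Hy j)
        + 2 * (\<Sum>i\<in>UNIV. (H i j)\<^sup>2) + 2 * (\<Sum>i\<in>UNIV. y i * W i j))" for j
      unfolding qjj_def sum.distrib by (simp add: algebra_simps power2_eq_square)
    then have "(\<Sum>j\<in>UNIV. qjj j) = a * ((m - 1)\<^sup>2 * h * h + (m - 1) * h * D + 4 * (m - 1) * \<eta> + 2 * \<sigma> + 2 * \<tau>)"
      unfolding \<sigma>' \<tau>' \<eta>_def D_def
      by (simp add: sum_distrib_left[symmetric] sum.distrib h_def)
    then show ?thesis by (simp add: power2_eq_square mult_ac)
  qed
  have "0 = (\<Sum>j\<in>UNIV. y j * (z j * Q + \<phi> * (c * t * qj j + y j)))" by (simp add: grad)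
  also have "\<dots> = (\<Sum>j\<in>UNIV. Q * (z j * y j) + \<phi> * (c * t * (y j * qj j)) + \<phi> * (y j)\<^sup>2)"
    by (intro sum.cong) (auto simp: algebra_simps power2_eq_square)
  also have "\<dots> = Q * P + \<phi> * (c * t * (a * ((m - 1) * h * h + 2 * \<eta>))) + \<phi> * h"
    unfolding yq[symmetric] by (simp add: sum.distrib sum_distrib_left P_def h_def)
  finally have grad_sum: "0 = Q * P + \<phi> * (c * t * (a * ((m - 1) * h * h + 2 * \<eta>))) + \<phi> * h" .
  have "0 \<ge> (\<Sum>j\<in>UNIV. zz j * Q + 2 * z j * (c * t * qj j + y j) + \<phi> * (c * t * qjj j + H j j))"
    by (intro sum_nonpos hess)
  also have "(\<Sum>j\<in>UNIV. zz j * Q + 2 * z j * (c * t * qj j + y j) + \<phi> * (c * t * qjj j + H j j))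
      = (\<Sum>j\<in>UNIV. Q * zz j + 2 * (c * t * (z j * qj j)) + 2 * (z j * y j) + \<phi> * (c * t * qjj j) + \<phi> * H j j)"
    by (intro sum.cong) (auto simp: algebra_simps)
  also have "\<dots> = Q * \<Lambda> + 2 * (c * t * (a * ((m - 1) * h * P + 2 * \<kappa>))) + 2 * P
     + \<phi> * (c * t * (\<Sum>j\<in>UNIV. qjj j)) + \<phi> * D"
    unfolding zq[symmetric] by (simp add: sum.distrib sum_distrib_left P_def D_def \<Lambda>_def)
  finally have hess_sum: "Q * \<Lambda> + 2 * (c * t * (a * ((m - 1) * h * P + 2 * \<kappa>))) + 2 * P
     + \<phi> * (c * t * (a * ((m - 1)\<^sup>2 * h\<^sup>2 + (m - 1) * D * h + 4 * (m - 1) * \<eta> + 2 * \<sigma> + 2 * \<tau>))) + \<phi> * D \<le> 0"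
    unfolding qjj .
  let ?E = "\<phi> * (3 * m * (m - 1) * h * (D + m * h) + 2 * m * \<tau> + 4 * m\<^sup>2 * \<eta>)
      - m * \<phi> * ((m - 1)\<^sup>2 * h\<^sup>2 + (m - 1) * D * h + 4 * (m - 1) * \<eta> + 2 * \<sigma> + 2 * \<tau>)
      - m * h * \<Lambda> - 2 * m * ((m - 1) * h * P + 2 * \<kappa>)
      - 2 * m\<^sup>2 * (\<phi> * ((m - 1) * h\<^sup>2 + 2 * \<eta>) + h * P)"
  let ?B = "m * (2 * h * Z / \<phi> - h * \<Lambda> - 2 * m * h * P - 3 / 2 * (m + 1) * l * \<phi> * h\<^sup>2)"
  let ?grad = "Q * P + \<phi> * (c * t * (a * ((m - 1) * h * h + 2 * \<eta>))) + \<phi> * h"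
  let ?hess = "Q * \<Lambda> + 2 * (c * t * (a * ((m - 1) * h * P + 2 * \<kappa>))) + 2 * P
     + \<phi> * (c * t * (a * ((m - 1)\<^sup>2 * h\<^sup>2 + (m - 1) * D * h + 4 * (m - 1) * \<eta> + 2 * \<sigma> + 2 * \<tau>))) + \<phi> * D"
  have "P\<^sup>2 \<le> h * Z"
    unfolding P_def h_def Z_def by (subst mult.commute) (rule Cauchy_Schwarz_ineq_sum)
  moreover have "0 \<le> \<phi>\<^sup>2 * \<sigma> + (h * Z + P\<^sup>2) / 2 + \<phi>\<^sup>2 * (real CARD('n) * (1 - m)\<^sup>2 * h\<^sup>2 / 4) + 2 * \<phi> * \<kappa>
      - 2 * \<phi>\<^sup>2 * ((1 - m) * \<eta> - (1 - m) / 2 * h * D) - \<phi> * (1 - m) * h * P"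
    unfolding h_def P_def Z_def D_def \<sigma>_def \<eta>_def \<kappa>_def Hy_def
    by (rule hessian_square_nonneg[OF sym])
  ultimately have EB: "?E \<le> ?B" using assms(2,4) l by (intro localized_gradient_scalar)
  have "0 \<le> c * t * a\<^sup>2" using assms(2,3,5) by (auto simp: c_def)
  then have "c * t * a\<^sup>2 * ?E \<le> c * t * a\<^sup>2 * ?B" by (rule mult_left_mono[OF EB])
  moreover have "0 \<le> (m * a) * (- ?hess)" using hess_sum assms(2) \<open>0 < a\<close> by (intro mult_nonneg_nonneg) auto
  moreover have "2 * m\<^sup>2 * a * ?grad = 0" using grad_sum by simp
  \<comment> \<open>The Hessian conditions summed over all directions supply the Laplacian, and the
    gradient conditions paired with \<open>y\<close> supply the drift. Collecting the coefficients
    of \<open>\<phi> a h\<close> gives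
    \<open>m (m - \<rho>) + m^2 - 2 m^2 = - m \<rho>\<close>.\<close>
  moreover have "\<phi> * (c * (a * h) + c * t * qt + wt) + (m * a) * (- ?hess) - 2 * m\<^sup>2 * a * ?grad
    = c * t * a\<^sup>2 * ?E - m * \<rho> * \<phi> * (a * h) - m * a * w * \<Lambda> - 2 * m * a * (1 + m * w) * P"
    unfolding qt wt_def Q_def c_def by (simp add: algebra_simps power2_eq_square)
  ultimately show ?thesis by (simp only: mult.assoc)
qed

section \<open>The cutoff function\<close>

text \<open>
  The cutoff is the fourth power of \<open>profile r\<close>, where \<open>r = 1 - s\<close> and \<open>s\<close> increases from 0 to 1 across
  the annulus. The profile is flat to second order at \<open>r = 1\<close>, so that its extension by 1 is \<open>C\<^sup>2\<close>; the
  slope 3/2 at \<open>r = 0\<close> is small enough for \<open>slope_power4_le\<close> and \<open>profile_concavity\<close>, which are what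
  the constant \<open>L\<close> of the theorem can absorb.
\<close>

definition profile :: "real \<Rightarrow> real" where
  "profile r = 3 / 2 * r - 3 / 2 * r ^ 5 + r ^ 6"

definition slope :: "real \<Rightarrow> real" where
  "slope r = 3 / 2 * (1 - 5 * r ^ 4 + 4 * r ^ 5)"

definition curv :: "real \<Rightarrow> real" where
  "curv r = 30 * r ^ 3 * (1 - r)"

lemma profile_deriv: "(profile has_real_derivative slope r) (at r)"
  unfolding profile_def[abs_def] slope_def
  by (auto intro!: derivative_eq_intros simp: field_simps)

lemma slope_deriv: "(slope has_real_derivative - curv r) (at r)"
  unfolding slope_def[abs_def] curv_def
  by (auto intro!: derivative_eq_intros simp: field_simps eval_nat_numeral)

lemma slope_factor: "slope r = 3 / 2 * ((1 - r)\<^sup>2 * (1 + 2 * r + 3 * r\<^sup>2 + 4 * r ^ 3))"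
  by (simp add: slope_def field_simps eval_nat_numeral)

lemma
  assumes "0 \<le> r" "r \<le> 1"
  shows slope_nonneg: "0 \<le> slope r" and slope_le: "slope r \<le> 3 / 2"
    and curv_nonneg: "0 \<le> curv r" and curv_le: "curv r \<le> 4"
proof -
  show "0 \<le> slope r" using assms by (simp add: slope_factor)
  have "0 \<le> r ^ 4 * (5 - 4 * r)" using assms by simp
  then show "slope r \<le> 3 / 2" by (simp add: slope_def field_simps eval_nat_numeral)
  show "0 \<le> curv r" using assms by (simp add: curv_def)
  \<comment> \<open>On the unit interval \<open>r^3 (1 - r)\<close> is maximal at \<open>3/4\<close>
    with value \<open>27/256\<close>, hence the double root there and a positive remainder.\<close>
  have "4 - curv r = 30 * (r - 3 / 4)\<^sup>2 * (r\<^sup>2 + r / 2 + 3 / 16) + (4 - 30 * 27 / 256)"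
    by (simp add: curv_def field_simps eval_nat_numeral)
  also have "\<dots> \<ge> 0" using assms by (intro add_nonneg_nonneg mult_nonneg_nonneg) auto
  finally show "curv r \<le> 4" by simp
qed

lemma
  assumes "0 \<le> r" "r \<le> 1"
  shows profile_le: "profile r \<le> 1" and profile_le_linear: "profile r \<le> 3 / 2 * r"
proof -
  have "1 - profile r = (1 - r) ^ 3 * (1 + 3 / 2 * r + 3 / 2 * r\<^sup>2 + r ^ 3)"
    by (simp add: profile_def field_simps eval_nat_numeral)
  also have "\<dots> \<ge> 0" using assms by (intro mult_nonneg_nonneg add_nonneg_nonneg) auto
  finally show "profile r \<le> 1" by simp
  have "0 \<le> r ^ 5 * (3 / 2 - r)" using assms by simp
  then show "profile r \<le> 3 / 2 * r" by (simp add: profile_def field_simps eval_nat_numeral)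
qed

lemma profile_pos:
  assumes "0 < r" "r \<le> 1"
  shows "0 < profile r"
proof -
  have "r ^ 5 \<le> r ^ 1" using assms by (intro power_decreasing) auto
  moreover have "0 < r ^ 6" by (rule zero_less_power[OF assms(1)])
  ultimately show ?thesis unfolding profile_def power_one_right by linarith
qed

text \<open>The derivative of the fourth power satisfies
  \<open>(4 p^3 p')^2 = 16 p^4 (p p')^2\<close>, so this bound controls the squared gradient of the
  cutoff by a multiple of the cutoff itself, the 16 being the one in
  \<open>L = 4 Ds + 16 N\<close>.\<close>

lemma profile_slope_le:
  assumes "0 \<le> r" "r \<le> 1"
  shows "profile r * slope r \<le> 1"
proof -
  \<comment> \<open>\<open>?q\<close> is the quotient of \<open>4/9 - r + 5 r^5 - 4 r^6\<close> by \<open>(r - 27/50)^2\<close>; the minimum is near \<open>27/50\<close>.\<close>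
  let ?q = "452709 / 312500 + 115911 / 62500 * r + 1188 / 625 * r\<^sup>2 + 17 / 25 * r ^ 3 - 4 * r ^ 4"
  have "profile r * slope r \<le> 3 / 2 * r * slope r"
    using profile_le_linear[OF assms] slope_nonneg[OF assms] by (rule mult_right_mono)
  moreover have "1 - 3 / 2 * r * slope r
      = 9 / 4 * ((r - 27 / 50)\<^sup>2 * ?q + 154776251 / 7031250000 + 3713741 / 156250000 * r)"
    by (simp add: slope_def field_simps eval_nat_numeral)
  moreover have "0 \<le> ?q"
  proof -
    have "r ^ 4 \<le> r ^ k" if "k \<le> 4" for k using that assms by (intro power_decreasing)
    from this[of 0] this[of 1] this[of 2] show ?thesis
      using assms zero_le_power[of r 3] unfolding power_0 power_one_right by linarith
  qed
  then have "0 \<le> 9 / 4 * ((r - 27 / 50)\<^sup>2 * ?q + 154776251 / 7031250000 + 3713741 / 156250000 * r)"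
    using assms by (intro mult_nonneg_nonneg add_nonneg_nonneg) auto
  ultimately show ?thesis by linarith
qed

text \<open>Replacing one factor of \<open>slope r\<close> by \<open>3/2\<close> and
  \<open>profile r\<close> by \<open>3/2 r\<close> makes the fifth powers cancel and leaves
  \<open>45 - 45 r^4\<close>. The left side is the coefficient of the squared gradient of
  \<open>s\<close> in the term \<open>A\<close> below, and 48 is 3 times the weight 16 of that
  quantity in \<open>L\<close>.\<close>

lemma profile_concavity:
  assumes "0 \<le> r" "r \<le> 1"
  shows "20 * (slope r)\<^sup>2 + 4 * profile r * curv r \<le> 48"
proof -
  have "slope r * slope r \<le> 3 / 2 * slope r"
    using slope_le[OF assms] slope_nonneg[OF assms] by (rule mult_right_mono)
  moreover have "profile r * curv r \<le> 3 / 2 * r * curv r"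
    using profile_le_linear[OF assms] curv_nonneg[OF assms] by (rule mult_right_mono)
  moreover have "30 * slope r + 6 * r * curv r = 45 - 45 * r ^ 4"
    by (simp add: slope_def curv_def field_simps eval_nat_numeral)
  moreover have "0 \<le> r ^ 4" by simp
  ultimately show ?thesis unfolding power2_eq_square by linarith
qed

lemma slope_power4_le:
  assumes "0 \<le> r" "r \<le> 1"
  shows "slope r ^ 4 \<le> 16 / 3"
proof -
  have "slope r ^ 4 \<le> (3 / 2) ^ 4"
    using slope_le[OF assms] slope_nonneg[OF assms] by (rule power_mono)
  then show ?thesis by (simp add: eval_nat_numeral)
qed

text \<open>At 0 the right difference quotient tends to \<open>F' 0 = 0\<close> and the left one is
  identically 0. Applied to \<open>bump\<close> and then to \<open>bump1\<close>, this gives the two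
  derivatives of the cutoff across the inner sphere.\<close>

lemma DERIV_truncated:
  fixes F F' :: "real \<Rightarrow> real"
  assumes F: "\<And>s. (F has_real_derivative F' s) (at s)" and "F' 0 = 0"
  shows "((\<lambda>s. F (max s 0)) has_real_derivative F' (max s 0)) (at s)"
proof -
  consider "s > 0" | "s < 0" | "s = 0" by linarith
  then show ?thesis
  proof cases
    case 1
    have "eventually (\<lambda>t. t > 0) (nhds s)" using 1 eventually_nhds_in_open[of "{0<..}" s] by simp
    then have "eventually (\<lambda>t. F (max t 0) = F t) (nhds s)" by eventually_elim simp
    then show ?thesis using DERIV_cong_ev[OF refl _ refl] F[of s] 1 by fastforce
  next
    case 2
    have "eventually (\<lambda>t. t < 0) (nhds s)" using 2 eventually_nhds_in_open[of "{..<0}" s] by simp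
    then have "eventually (\<lambda>t. F (max t 0) = F 0) (nhds s)" by eventually_elim simp
    then show ?thesis using DERIV_cong_ev[OF refl _ refl] 2 assms(2) by fastforce
  next
    case 3
    have "((\<lambda>t. (F t - F 0) / t) \<longlongrightarrow> 0) (at 0)"
      using F[of 0] assms(2) by (simp add: has_field_derivative_iff)
    then have "((\<lambda>t. (F t - F 0) / t) \<longlongrightarrow> 0) (at_right 0)"
      by (simp add: filterlim_at_split)
    then have "((\<lambda>t. (F (max t 0) - F 0) / t) \<longlongrightarrow> 0) (at_right 0)"
      by (rule Lim_transform_eventually) (auto simp: eventually_at_filter)
    moreover have "((\<lambda>t. (F (max t 0) - F 0) / t) \<longlongrightarrow> 0) (at_left 0)"
      by (rule Lim_transform_eventually[of "\<lambda>_. 0"]) (auto simp: eventually_at_filter)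
    ultimately show ?thesis
      using 3 assms(2) by (simp add: has_field_derivative_iff filterlim_at_split)
  qed
qed

text \<open>The exponent 4 is dictated by the drift term, of size
  \<open>h^(3/2) |\<nabla>\<phi>|\<close>. Absorbing it into \<open>\<phi> h^2\<close> by Young's
  inequality requires \<open>|\<nabla>\<phi>|^4\<close> to be bounded by a multiple of
  \<open>\<phi>^3\<close>, which holds for fourth powers.\<close>

definition bump :: "real \<Rightarrow> real" where "bump s = profile (1 - s) ^ 4"
definition bump1 :: "real \<Rightarrow> real" where "bump1 s = - 4 * profile (1 - s) ^ 3 * slope (1 - s)"
definition bump2 :: "real \<Rightarrow> real" where
  "bump2 s = 12 * (profile (1 - s) * slope (1 - s))\<^sup>2 - 4 * profile (1 - s) ^ 3 * curv (1 - s)"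

lemma bump_deriv: "(bump has_real_derivative bump1 s) (at s)"
  unfolding bump_def[abs_def] bump1_def
  by (auto intro!: derivative_eq_intros DERIV_chain2[OF profile_deriv] simp: field_simps)

lemma bump1_deriv: "(bump1 has_real_derivative bump2 s) (at s)"
  unfolding bump1_def[abs_def] bump2_def
  by (auto intro!: derivative_eq_intros DERIV_chain2[OF profile_deriv] DERIV_chain2[OF slope_deriv]
      simp: field_simps eval_nat_numeral)

lemma bump_at_0: "bump 0 = 1" "bump1 0 = 0" "bump2 0 = 0"
  by (simp_all add: bump_def bump1_def bump2_def profile_def slope_def curv_def)

text \<open>\<open>Ns\<close> and \<open>Ds\<close> stand for the squared gradient and the Laplacian
  of the untruncated radial variable. The three bounds serve the three ways in which the cutoff
  enters: in the cross term with the gradient of \<open>w\<close>, as a Laplacian multiplied by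
  \<open>w\<close>, and in the terms competing with the negative quadratic one.\<close>

lemma
  fixes s Ns Ds N L h P m l :: real
  assumes s: "0 \<le> s" "s < 1" and "0 \<le> Ns" "Ns \<le> N" "0 \<le> Ds" and L: "L = 4 * Ds + 16 * N"
  shows bump_gradient_le: "(bump1 s)\<^sup>2 * Ns \<le> bump s * L"
    and bump_laplacian_le: "\<bar>bump1 s * Ds + bump2 s * Ns\<bar> \<le> L"
    and bump_absorption: "\<lbrakk>0 \<le> h; P\<^sup>2 \<le> h * ((bump1 s)\<^sup>2 * Ns); 0 < m; m < 1; 0 < l; 9 * l\<^sup>2 \<le> 1 - m\<rbrakk> \<Longrightarrow>
      2 * h * ((bump1 s)\<^sup>2 * Ns) / bump s - h * (bump1 s * Ds + bump2 s * Ns) - 2 * m * h * P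
        - 3 / 2 * (m + 1) * l * bump s * h\<^sup>2
      \<le> (m / 2 * (1 / l ^ 3) + 3 / 2 * (1 / l)) * L\<^sup>2"
proof -
  define r where "r = 1 - s"
  have r: "0 < r" "0 \<le> r" "r \<le> 1" using s by (auto simp: r_def)
  define p f g where "p = profile r" and "f = slope r" and "g = curv r"
  have p: "0 < p" "p \<le> 1" using profile_pos profile_le r by (auto simp: p_def)
  have f: "0 \<le> f" "f \<le> 3 / 2" "p * f \<le> 1" "f ^ 4 \<le> 16 / 3"
    using slope_nonneg slope_le profile_slope_le slope_power4_le r by (auto simp: p_def f_def)
  have g: "0 \<le> g" "g \<le> 4" "20 * f\<^sup>2 + 4 * p * g \<le> 48"
    using curv_nonneg curv_le profile_concavity r by (auto simp: p_def f_def g_def)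
  have b: "bump s = p ^ 4" "bump1 s = - 4 * p ^ 3 * f" "bump2 s = 12 * (p * f)\<^sup>2 - 4 * p ^ 3 * g"
    by (simp_all add: bump_def bump1_def bump2_def p_def f_def g_def r_def)
  have N: "0 \<le> N" "0 \<le> L" using assms by auto
  have pf: "0 \<le> p * f" "(p * f)\<^sup>2 \<le> 1" using p f by (auto simp: power_le_one)
  have p3: "p ^ 3 \<le> 1" "p\<^sup>2 \<le> 1" "0 \<le> p ^ 3" using p by (auto simp: power_le_one)
  have "(bump1 s)\<^sup>2 * Ns = p ^ 4 * (16 * ((p * f)\<^sup>2 * Ns))"
    by (simp add: b eval_nat_numeral)
  also have "\<dots> \<le> p ^ 4 * L"
  proof (rule mult_left_mono)
    have "(p * f)\<^sup>2 * Ns \<le> 1 * N" using pf assms by (intro mult_mono) auto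
    then show "16 * ((p * f)\<^sup>2 * Ns) \<le> L" using L assms by simp
  qed simp
  finally show "(bump1 s)\<^sup>2 * Ns \<le> bump s * L" by (simp add: b)
  show "\<bar>bump1 s * Ds + bump2 s * Ns\<bar> \<le> L"
  proof -
    have "p\<^sup>2 * (p * f) \<le> 1 * 1" using p p3 f pf by (intro mult_mono) auto
    then have "\<bar>bump1 s\<bar> \<le> 4" using p f by (simp add: b abs_mult eval_nat_numeral mult_ac)
    then have 1: "\<bar>bump1 s * Ds\<bar> \<le> 4 * Ds"
      using assms by (simp add: abs_mult mult_right_mono)
    have "p ^ 3 * g \<le> 1 * 4" using p3 g by (intro mult_mono) auto
    moreover have "0 \<le> p ^ 3 * g" "0 \<le> (p * f)\<^sup>2" using p3 g by auto
    ultimately have "\<bar>bump2 s\<bar> \<le> 16" using pf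
      unfolding b abs_le_iff mult.assoc by linarith
    then have "\<bar>bump2 s\<bar> * Ns \<le> 16 * N" using assms by (intro mult_mono) auto
    then have "\<bar>bump2 s * Ns\<bar> \<le> 16 * N" using assms by (simp add: abs_mult)
    with 1 show ?thesis unfolding L by linarith
  qed
  assume h: "0 \<le> h" and P: "P\<^sup>2 \<le> h * ((bump1 s)\<^sup>2 * Ns)"
    and m: "0 < m" "m < 1" and l: "0 < l" "9 * l\<^sup>2 \<le> 1 - m"
  \<comment> \<open>With \<open>X = p sqrt h\<close> all powers of \<open>p\<close> are absorbed:
    \<open>\<phi> h^2\<close> is \<open>X^4\<close>, the drift term is at most
    \<open>2 m X^3 \<beta>\<close>, and the remaining error is \<open>X^2 A\<close>. Here
    \<open>20 = 32 - 12\<close>, the 32 coming from the quotient by the cutoff and the 12 from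
    \<open>bump2\<close>.\<close>
  define X A \<beta> where "X = p * sqrt h" and "A = (20 * f\<^sup>2 + 4 * p * g) * Ns + 4 * (p * f) * Ds"
    and "\<beta> = 4 * f * sqrt Ns"
  have "(20 * f\<^sup>2 + 4 * p * g) * Ns \<le> 48 * N"
    using g assms p f by (intro mult_mono) auto
  moreover have "(p * f) * Ds \<le> 1 * Ds" using f assms by (intro mult_right_mono) auto
  moreover have "A = (20 * f\<^sup>2 + 4 * p * g) * Ns + 4 * ((p * f) * Ds)" by (simp add: A_def)
  ultimately have A: "A \<le> 3 * L" using \<open>0 \<le> Ds\<close> L by (smt (verit))
  have \<beta>: "\<beta> ^ 4 \<le> 16 / 3 * L\<^sup>2"
  proof -
    have "\<beta> ^ 4 = 256 * (f ^ 4 * Ns\<^sup>2)"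
      using assms(3) by (simp add: \<beta>_def power_mult_distrib power4_eq_xxxx power2_eq_square)
    also have "\<dots> \<le> 256 * (16 / 3 * N\<^sup>2)"
      using f assms by (intro mult_left_mono mult_mono power_mono) auto
    also have "\<dots> = 16 / 3 * (16 * N)\<^sup>2" by (simp add: power2_eq_square)
    also have "\<dots> \<le> 16 / 3 * L\<^sup>2" using N assms by (intro mult_left_mono power_mono) auto
    finally show ?thesis .
  qed
  have X: "X\<^sup>2 = p\<^sup>2 * h" "X ^ 4 = p ^ 4 * h\<^sup>2" "X ^ 3 = p ^ 3 * (h * sqrt h)"
    using h by (simp_all add: X_def power_mult_distrib power4_eq_xxxx power2_eq_square power3_eq_cube)
  have "\<bar>P\<bar> \<le> sqrt h * (4 * p ^ 3 * f * sqrt Ns)"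
  proof (rule power2_le_imp_le)
    show "\<bar>P\<bar>\<^sup>2 \<le> (sqrt h * (4 * p ^ 3 * f * sqrt Ns))\<^sup>2"
      using P h assms(3) by (simp add: b power_mult_distrib mult_ac)
    show "0 \<le> sqrt h * (4 * p ^ 3 * f * sqrt Ns)" using h f p assms(3) by simp
  qed
  then have "- P \<le> sqrt h * (4 * p ^ 3 * f * sqrt Ns)" by simp
  then have "2 * m * h * (- P) \<le> 2 * m * h * (sqrt h * (4 * p ^ 3 * f * sqrt Ns))"
    using m h by (intro mult_left_mono) auto
  then have 2: "- 2 * m * h * P \<le> 2 * m * X ^ 3 * \<beta>" by (simp add: X \<beta>_def mult_ac)
  have 4: "2 * h * ((bump1 s)\<^sup>2 * Ns) / bump s = 32 * (p\<^sup>2 * f\<^sup>2 * Ns * h)"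
    using p by (simp add: b field_simps eval_nat_numeral)
  have 3: "2 * h * ((bump1 s)\<^sup>2 * Ns) / bump s - h * (bump1 s * Ds + bump2 s * Ns) = X\<^sup>2 * A"
    unfolding 4 unfolding b X(1) A_def by (simp add: algebra_simps eval_nat_numeral)
  have "X\<^sup>2 * A + 2 * m * X ^ 3 * \<beta> - 3 / 2 * (m + 1) * l * X ^ 4
    \<le> (m / 2 * (1 / l ^ 3) + 3 / 2 * (1 / l)) * L\<^sup>2"
    by (rule young_absorption) (use m l N A \<beta> in auto)
  moreover have "3 / 2 * (m + 1) * l * bump s * h\<^sup>2 = 3 / 2 * (m + 1) * l * X ^ 4"
    by (simp add: b X)
  ultimately show "2 * h * ((bump1 s)\<^sup>2 * Ns) / bump s - h * (bump1 s * Ds + bump2 s * Ns) - 2 * m * h * P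
        - 3 / 2 * (m + 1) * l * bump s * h\<^sup>2
      \<le> (m / 2 * (1 / l ^ 3) + 3 / 2 * (1 / l)) * L\<^sup>2" using 2 3 by linarith
qed

section \<open>The cutoff as a function on space\<close>

lemma radial_dir_deriv:
  fixes x x0 :: "real^'n"
  shows "has_dir_deriv (\<lambda>x. k * ((norm (x - x0))\<^sup>2 - b)) (axis j 1) x (2 * k * (x - x0) $ j)"
proof -
  have "(norm (x + s *\<^sub>R axis j 1 - x0))\<^sup>2 = (norm (x - x0))\<^sup>2 + 2 * s * (x - x0) $ j + s\<^sup>2" for s
    by (simp only: power2_norm_eq_inner)
       (simp add: algebra_simps inner_axis inner_axis' inner_axis_axis power2_eq_square)
  then show ?thesis
    unfolding has_dir_deriv_def by (auto intro!: derivative_eq_intros)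
qed

text \<open>The inner factor is the derivative of the radial variable before truncation. Where
  \<open>s\<close> is clipped to 0, \<open>bump1\<close> and \<open>bump2\<close> vanish, so the
  same formulas hold everywhere without a case distinction.\<close>

lemma cutoff_dir_deriv:
  fixes x x0 :: "real^'n" and k b :: real
  defines "s \<equiv> \<lambda>x. max (k * ((norm (x - x0))\<^sup>2 - b)) 0"
  shows "has_dir_deriv (\<lambda>x. bump (s x)) (axis j 1) x (bump1 (s x) * (2 * k * (x - x0) $ j))"
    and "has_dir_deriv (\<lambda>x. bump1 (s x) * (2 * k * (x - x0) $ j)) (axis j 1) x
      (bump2 (s x) * (2 * k * (x - x0) $ j)\<^sup>2 + bump1 (s x) * (2 * k))"
proof -
  show "has_dir_deriv (\<lambda>x. bump (s x)) (axis j 1) x (bump1 (s x) * (2 * k * (x - x0) $ j))"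
    unfolding s_def
    by (rule has_dir_deriv_chain[where F = "\<lambda>s. bump (max s 0)"])
       (intro DERIV_truncated bump_deriv bump_at_0 radial_dir_deriv)+
  have "has_dir_deriv (\<lambda>x. bump1 (s x)) (axis j 1) x (bump2 (s x) * (2 * k * (x - x0) $ j))"
    unfolding s_def
    by (rule has_dir_deriv_chain[where F = "\<lambda>s. bump1 (max s 0)"])
       (intro DERIV_truncated bump1_deriv bump_at_0 radial_dir_deriv)+
  moreover have "has_dir_deriv (\<lambda>x. 2 * k * (x - x0) $ j) (axis j 1) x (2 * k)"
    unfolding has_dir_deriv_def by (auto intro!: derivative_eq_intros simp: axis_def)
  ultimately show "has_dir_deriv (\<lambda>x. bump1 (s x) * (2 * k * (x - x0) $ j)) (axis j 1) x
      (bump2 (s x) * (2 * k * (x - x0) $ j)\<^sup>2 + bump1 (s x) * (2 * k))"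
    by (rule has_dir_deriv_eq[OF has_dir_deriv_mult]) (simp add: power2_eq_square)
qed

lemma sum_cutoff_dir_deriv:
  fixes x x0 :: "real^'n"
  shows "(\<Sum>j\<in>UNIV. (\<beta>1 * (2 * k * (x - x0) $ j))\<^sup>2) = \<beta>1\<^sup>2 * (4 * k\<^sup>2 * (norm (x - x0))\<^sup>2)"
    and "(\<Sum>j\<in>UNIV. \<beta>2 * (2 * k * (x - x0) $ j)\<^sup>2 + \<beta>1 * (2 * k))
      = \<beta>1 * (2 * real CARD('n) * k) + \<beta>2 * (4 * k\<^sup>2 * (norm (x - x0))\<^sup>2)"
proof -
  define d where "d = (\<lambda>j. (x - x0) $ j)"
  have n: "(norm (x - x0))\<^sup>2 = (\<Sum>j\<in>UNIV. (d j)\<^sup>2)"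
    unfolding power2_norm_eq_inner inner_vec_def d_def by (simp add: power2_eq_square)
  have "(\<Sum>j\<in>UNIV. (\<beta>1 * (2 * k * d j))\<^sup>2) = \<beta>1\<^sup>2 * (4 * k\<^sup>2 * (\<Sum>j\<in>UNIV. (d j)\<^sup>2))"
    by (simp add: sum_distrib_left power_mult_distrib)
  then show "(\<Sum>j\<in>UNIV. (\<beta>1 * (2 * k * (x - x0) $ j))\<^sup>2) = \<beta>1\<^sup>2 * (4 * k\<^sup>2 * (norm (x - x0))\<^sup>2)"
    by (simp only: n d_def)
  have "(\<Sum>j\<in>UNIV. \<beta>2 * (2 * k * d j)\<^sup>2 + \<beta>1 * (2 * k))
      = \<beta>1 * (2 * real CARD('n) * k) + \<beta>2 * (4 * k\<^sup>2 * (\<Sum>j\<in>UNIV. (d j)\<^sup>2))"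
    by (simp add: sum_distrib_left sum.distrib power_mult_distrib)
  then show "(\<Sum>j\<in>UNIV. \<beta>2 * (2 * k * (x - x0) $ j)\<^sup>2 + \<beta>1 * (2 * k))
      = \<beta>1 * (2 * real CARD('n) * k) + \<beta>2 * (4 * k\<^sup>2 * (norm (x - x0))\<^sup>2)"
    by (simp only: n d_def)
qed

section \<open>Absorbing the cutoff errors into the source terms\<close>

lemma four_mult_le_square_sum: "4 * x * y \<le> (x + y)\<^sup>2" for x y :: real
  using zero_le_power2[of "x - y"] unfolding power2_sum power2_diff by linarith

lemma localization_source_nonpos:
  fixes m \<rho> l a h t w \<phi> P Z \<Lambda> c L K M1 M3 :: real
  assumes m: "0 < \<rho>" "\<rho> < m" and "0 < a" "0 \<le> h" "0 \<le> t" "0 < \<phi>" "0 \<le> K" "0 \<le> L" "0 \<le> c"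
    and P: "P\<^sup>2 \<le> h * Z" and Z: "Z \<le> \<phi> * L" and \<Lambda>: "\<bar>\<Lambda>\<bar> \<le> L" and B: "B \<le> K * L\<^sup>2"
    and M1: "a\<^sup>2 \<le> M1" and M3: "(\<rho> * \<bar>w\<bar> + (m * w + 1)\<^sup>2) * a \<le> M3"
  shows "c * t * (a\<^sup>2 * (m * B)) - m * \<rho> * \<phi> * (a * h) - m * a * w * \<Lambda> - 2 * m * a * (1 + m * w) * P
    - m / \<rho> * L * M3 - c * K * m * M1 * L\<^sup>2 * t \<le> 0"
proof -
  have "a\<^sup>2 * (m * B) \<le> a\<^sup>2 * (m * (K * L\<^sup>2))" using B m by (intro mult_left_mono) auto
  also have "\<dots> \<le> M1 * (m * (K * L\<^sup>2))" using M1 m assms by (intro mult_right_mono) auto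
  finally have 1: "c * t * (a\<^sup>2 * (m * B)) \<le> c * t * (M1 * (m * (K * L\<^sup>2)))"
    using assms by (intro mult_left_mono) auto
  have "- w * \<Lambda> \<le> \<bar>w\<bar> * L"
  proof -
    have "- w * \<Lambda> \<le> \<bar>w\<bar> * \<bar>\<Lambda>\<bar>" by (metis abs_ge_self abs_minus_cancel abs_mult)
    also have "\<dots> \<le> \<bar>w\<bar> * L" using \<Lambda> by (intro mult_left_mono) auto
    finally show ?thesis .
  qed
  \<comment> \<open>Here \<open>\<rho> \<phi> h\<close> is spent. Since
    \<open>P^2 \<le> h \<phi> L\<close>, the cross term is at most twice the geometric mean of
    \<open>\<rho> \<phi> h\<close> and \<open>(m w + 1)^2 L / \<rho>\<close>. Together with
    \<open>|w| L\<close> from the Laplacian this yields the quantity whose bound is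
    \<open>M3\<close>.\<close>
  moreover have "- 2 * (1 + m * w) * P \<le> \<rho> * \<phi> * h + (m * w + 1)\<^sup>2 * L / \<rho>"
  proof -
    have "h * Z \<le> h * (\<phi> * L)" using Z assms by (intro mult_left_mono) auto
    then have PL: "P\<^sup>2 \<le> h * (\<phi> * L)" using P by linarith
    have "(- 2 * (1 + m * w) * P)\<^sup>2 = 4 * (m * w + 1)\<^sup>2 * P\<^sup>2"
      by (simp add: power2_eq_square algebra_simps)
    also have "\<dots> \<le> 4 * (m * w + 1)\<^sup>2 * (h * (\<phi> * L))" using PL by (intro mult_left_mono) auto
    also have "\<dots> = 4 * (\<rho> * \<phi> * h) * ((m * w + 1)\<^sup>2 * L / \<rho>)" using m by simp
    also have "\<dots> \<le> (\<rho> * \<phi> * h + (m * w + 1)\<^sup>2 * L / \<rho>)\<^sup>2"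
      by (rule four_mult_le_square_sum)
    finally show ?thesis
      using assms by (intro power2_le_imp_le[of "- 2 * (1 + m * w) * P"]) auto
  qed
  ultimately have "- w * \<Lambda> + - 2 * (1 + m * w) * P - \<rho> * \<phi> * h
      \<le> L / \<rho> * (\<rho> * \<bar>w\<bar> + (m * w + 1)\<^sup>2)"
    using m by (simp add: algebra_simps)
  then have "(m * a) * (- w * \<Lambda> + - 2 * (1 + m * w) * P - \<rho> * \<phi> * h)
      \<le> (m * a) * (L / \<rho> * (\<rho> * \<bar>w\<bar> + (m * w + 1)\<^sup>2))"
    using m assms by (intro mult_left_mono) auto
  also have "\<dots> = m / \<rho> * L * ((\<rho> * \<bar>w\<bar> + (m * w + 1)\<^sup>2) * a)" by simp
  also have "\<dots> \<le> m / \<rho> * L * M3" using M3 m assms by (intro mult_left_mono) auto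
  finally show ?thesis using 1 by (simp add: algebra_simps)
qed

section \<open>The maximum principle\<close>

definition space_dir :: "'n \<Rightarrow> real \<times> (real^'n)" where "space_dir j = (0, axis j 1)"
definition time_dir :: "real \<times> (real^'n)" where "time_dir = (1, 0)"

lemma space_time_dir_simps [simp]:
  "fst (space_dir j) = 0" "snd (space_dir j) = axis j 1" "fst time_dir = 1" "snd time_dir = 0"
  by (simp_all add: space_dir_def time_dir_def)

text \<open>Turns the first and second order tests at a maximum of \<open>F\<close> into the
  numerical hypotheses of \<open>evolution_inequality\<close>. The time derivative of the penalty
  \<open>\<delta> * fst p\<close> is what stands alone on the left.\<close>

lemma maximum_point_inequality:
  fixes w :: "real \<times> (real^'n) \<Rightarrow> real" and \<phi> :: "real^'n \<Rightarrow> real"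
    and \<phi>1 \<phi>2 :: "'n \<Rightarrow> real^'n \<Rightarrow> real" and m \<rho> l C1 C2 \<delta> :: real
  defines "wi \<equiv> \<lambda>i. dir_deriv (space_dir i) w"
  defines "a \<equiv> \<lambda>p. exp ((m - 1) * w p)" and "h \<equiv> \<lambda>p. \<Sum>i\<in>UNIV. (wi i p)\<^sup>2"
  assumes \<Omega>: "open \<Omega>" and w: "smooth_within \<Omega> w"
    and pde: "\<And>p. p \<in> \<Omega> \<Longrightarrow> dir_deriv time_dir w p
      = m * a p * ((\<Sum>j\<in>UNIV. dir_deriv (space_dir j) (wi j) p) + m * h p)"
    and \<phi>1: "\<And>j x. has_dir_deriv \<phi> (axis j 1) x (\<phi>1 j x)"
    and \<phi>2: "\<And>j x. has_dir_deriv (\<phi>1 j) (axis j 1) x (\<phi>2 j x)"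
    and m: "0 < m" "\<rho> < m"
    and l: "l * (3 * (m + 1)) = - real CARD('n) * (m - 1)\<^sup>2 - 2 * (m - 1)"
  defines "F \<equiv> \<lambda>p. \<phi> (snd p) * (m * (m - \<rho>) * fst p * (a p * h p) + w p)
      - (C1 * fst p + C2 / 2 * (fst p)\<^sup>2 + \<delta> * fst p)"
  assumes p: "p \<in> \<Omega>" "0 < fst p" "0 < \<phi> (snd p)"
    and max_space: "\<And>j. eventually (\<lambda>s. F (p + s *\<^sub>R space_dir j) \<le> F p) (nhds 0)"
    and max_time: "eventually (\<lambda>s. F (p + s *\<^sub>R time_dir) \<le> F p) (at_left 0)"
  shows "\<delta> \<le> m * (m - \<rho>) * fst p * ((a p)\<^sup>2 * (m * (2 * h p * (\<Sum>j\<in>UNIV. (\<phi>1 j (snd p))\<^sup>2) / \<phi> (snd p)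
        - h p * (\<Sum>j\<in>UNIV. \<phi>2 j (snd p)) - 2 * m * h p * (\<Sum>j\<in>UNIV. \<phi>1 j (snd p) * wi j p)
        - 3 / 2 * (m + 1) * l * \<phi> (snd p) * (h p)\<^sup>2)))
      - m * \<rho> * \<phi> (snd p) * (a p * h p) - m * a p * w p * (\<Sum>j\<in>UNIV. \<phi>2 j (snd p))
      - 2 * m * a p * (1 + m * w p) * (\<Sum>j\<in>UNIV. \<phi>1 j (snd p) * wi j p) - C1 - C2 * fst p"
proof -
  define c where "c = m * (m - \<rho>)"
  note smooth = w smooth_within_dir_deriv[OF \<Omega>]
  have wi_smooth: "smooth_within \<Omega> (wi i)" for i unfolding wi_def by (intro smooth)
  define H where "H = (\<lambda>i j. dir_deriv (space_dir j) (wi i))"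
  have H_smooth: "smooth_within \<Omega> (H i j)" for i j unfolding H_def by (intro smooth wi_smooth)
  define W where "W = (\<lambda>i j. dir_deriv (space_dir j) (H i j))"
  have H_sym: "H i j x = H j i x" if "x \<in> \<Omega>" for i j x
    unfolding H_def wi_def using dir_deriv_commute[OF \<Omega> w that] .
  have d_w: "has_dir_deriv w (space_dir j) x (wi j x)" if "x \<in> \<Omega>" for j x
    unfolding wi_def using smooth_has_dir_deriv[OF \<Omega> w that] .
  have d_wi: "has_dir_deriv (wi i) (space_dir j) x (H i j x)" if "x \<in> \<Omega>" for i j x
    unfolding H_def using smooth_has_dir_deriv[OF \<Omega> wi_smooth that] .
  have d_H: "has_dir_deriv (H i j) (space_dir j) x (W i j x)" if "x \<in> \<Omega>" for i j x
    unfolding W_def using smooth_has_dir_deriv[OF \<Omega> H_smooth that] .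
  \<comment> \<open>Third derivatives may be reordered, so the gradient of the Laplacian and the
    Laplacian of the gradient are expressed by the same numbers \<open>W i j\<close>. This is what
    later lets \<tau> cancel.\<close>
  have W_swap: "dir_deriv (space_dir i) (H j j) x = W i j x" if "x \<in> \<Omega>" for i j x
  proof -
    have "dir_deriv (space_dir i) (H j j) x = dir_deriv (space_dir j) (H j i) x"
      unfolding H_def using dir_deriv_commute[OF \<Omega> wi_smooth that] .
    also have "\<dots> = W i j x"
      unfolding W_def by (rule dir_deriv_cong[OF \<Omega> H_smooth H_smooth that]) (rule H_sym)
    finally show ?thesis .
  qed
  have d_a: "has_dir_deriv a k x (a x * ((m - 1) * d))" if "has_dir_deriv w k x d" for k x d
    unfolding a_def by (intro has_dir_deriv_exp has_dir_deriv_cmult that)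
  have d_h: "has_dir_deriv h (space_dir j) x (2 * (\<Sum>i\<in>UNIV. wi i x * H i j x))" if "x \<in> \<Omega>" for j x
    unfolding h_def sum_distrib_left
    by (intro has_dir_deriv_sum has_dir_deriv_power2 d_wi that)
  let ?D = "\<lambda>x. \<Sum>j\<in>UNIV. H j j x" and ?Hy = "\<lambda>j x. \<Sum>i\<in>UNIV. wi i x * H i j x"
  define wt where "wt = (\<lambda>x. m * a x * (?D x + m * h x))"
  have wt: "dir_deriv time_dir w x = wt x" if "x \<in> \<Omega>" for x
    using pde[OF that] by (simp add: wt_def H_def)
  define T where "T = (\<lambda>i x. \<Sum>j\<in>UNIV. W i j x)"
  define wti where "wti = (\<lambda>i x. m * a x * ((m - 1) * wi i x * (?D x + m * h x) + (T i x + 2 * m * ?Hy i x)))"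
  \<comment> \<open>The time derivative of the gradient is obtained by exchanging the two
    derivatives and differentiating the equation in space, which is legitimate because the equation
    holds on the whole open set.\<close>
  have d_wi_time: "has_dir_deriv (wi i) time_dir x (wti i x)" if x: "x \<in> \<Omega>" for i x
  proof -
    have "has_dir_deriv (H j j) (space_dir i) x (W i j x)" for j
      using smooth_has_dir_deriv[OF \<Omega> H_smooth x, of j j "space_dir i"] by (simp add: W_swap[OF x])
    then have "has_dir_deriv wt (space_dir i) x (wti i x)"
      unfolding wt_def mult.assoc
      by (intro has_dir_deriv_eq[OF has_dir_deriv_cmult[OF has_dir_deriv_mult[OF d_a[OF d_w[OF x]]
              has_dir_deriv_add[OF has_dir_deriv_sum has_dir_deriv_cmult[OF d_h[OF x]]]]]])
         (auto simp: wti_def T_def algebra_simps)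
    then have "has_dir_deriv (dir_deriv time_dir w) (space_dir i) x (wti i x)"
      using has_dir_deriv_cong[OF \<Omega> x, of "dir_deriv time_dir w" wt] wt by simp
    moreover have "has_dir_deriv (dir_deriv time_dir w) (space_dir i) x (dir_deriv time_dir (wi i) x)"
      unfolding wi_def using dir_deriv_commute[OF \<Omega> w x, of time_dir "space_dir i"]
        smooth_has_dir_deriv[OF \<Omega> smooth_within_dir_deriv[OF \<Omega> w, of time_dir] x, of "space_dir i"]
      by simp
    ultimately have "dir_deriv time_dir (wi i) x = wti i x" by (rule has_dir_deriv_unique[rotated])
    then show ?thesis using smooth_has_dir_deriv[OF \<Omega> wi_smooth x, of i time_dir] by simp
  qed
  define qj where "qj = (\<lambda>j x. a x * ((m - 1) * wi j x * h x + 2 * ?Hy j x))"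
  have d_q: "has_dir_deriv (\<lambda>x. a x * h x) (space_dir j) x (qj j x)" if "x \<in> \<Omega>" for j x
    by (rule has_dir_deriv_eq[OF has_dir_deriv_mult[OF d_a[OF d_w[OF that]] d_h[OF that]]])
       (simp add: qj_def algebra_simps)
  define qjj where "qjj = (\<lambda>j x. a x * ((m - 1) * wi j x * ((m - 1) * wi j x * h x + 2 * ?Hy j x)
      + (m - 1) * H j j x * h x + (m - 1) * wi j x * (2 * ?Hy j x)
      + 2 * (\<Sum>i\<in>UNIV. (H i j x)\<^sup>2 + wi i x * W i j x)))"
  have d_qj: "has_dir_deriv (qj j) (space_dir j) x (qjj j x)" if x: "x \<in> \<Omega>" for j x
  proof -
    have "has_dir_deriv (?Hy j) (space_dir j) x (\<Sum>i\<in>UNIV. H i j x * H i j x + wi i x * W i j x)"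
      by (intro has_dir_deriv_sum has_dir_deriv_mult d_wi d_H x)
    then show ?thesis unfolding qj_def mult.assoc
      by (intro has_dir_deriv_eq[OF has_dir_deriv_mult[OF d_a[OF d_w[OF x]]
           has_dir_deriv_add[OF has_dir_deriv_cmult[OF has_dir_deriv_mult[OF d_wi[OF x] d_h[OF x]]]
             has_dir_deriv_cmult]]])
        (auto simp: qjj_def algebra_simps power2_eq_square)
  qed
  define qt where "qt = (\<lambda>x. a x * ((m - 1) * wt x * h x + 2 * (\<Sum>i\<in>UNIV. wi i x * wti i x)))"
  have d_wt: "has_dir_deriv w time_dir x (wt x)" if "x \<in> \<Omega>" for x
    using smooth_has_dir_deriv[OF \<Omega> w that, of time_dir] by (simp add: wt[OF that])
  have d_qt: "has_dir_deriv (\<lambda>x. a x * h x) time_dir x (qt x)" if x: "x \<in> \<Omega>" for x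
  proof -
    have "has_dir_deriv h time_dir x (\<Sum>i\<in>UNIV. 2 * (wi i x * wti i x))"
      unfolding h_def by (intro has_dir_deriv_sum has_dir_deriv_power2 d_wi_time x)
    then show ?thesis
      by (intro has_dir_deriv_eq[OF has_dir_deriv_mult[OF d_a[OF d_wt[OF x]]]])
         (auto simp: qt_def algebra_simps sum_distrib_left)
  qed
  define Q where "Q = (\<lambda>x. c * fst x * (a x * h x) + w x)"
  have F: "F = (\<lambda>x. \<phi> (snd x) * Q x - (C1 * fst x + C2 / 2 * (fst x)\<^sup>2 + \<delta> * fst x))"
    by (simp add: F_def Q_def c_def)
  define Fj where "Fj = (\<lambda>j x. \<phi>1 j (snd x) * Q x + \<phi> (snd x) * (c * fst x * qj j x + wi j x))"
  have d_fst: "has_dir_deriv fst (space_dir j) x 0" for j and x :: "real \<times> (real^'n)"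
    using has_dir_deriv_fst[of "space_dir j" x] by simp
  have d_fst': "has_dir_deriv fst time_dir x 1" for x :: "real \<times> (real^'n)"
    using has_dir_deriv_fst[of time_dir x] by simp
  have d_\<phi>: "has_dir_deriv (\<lambda>x. \<phi> (snd x)) (space_dir j) x (\<phi>1 j (snd x))"
    and d_\<phi>1: "has_dir_deriv (\<lambda>x. \<phi>1 j (snd x)) (space_dir j) x (\<phi>2 j (snd x))" for j x
    using \<phi>1 \<phi>2 by (auto intro!: has_dir_deriv_snd)
  have d_Q: "has_dir_deriv Q (space_dir j) x (c * fst x * qj j x + wi j x)" if x: "x \<in> \<Omega>" for j x
    unfolding Q_def
    by (rule has_dir_deriv_eq[OF has_dir_deriv_add[OF has_dir_deriv_mult[OF
          has_dir_deriv_cmult[OF d_fst] d_q[OF x]] d_w[OF x]]]) auto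
  have d_F: "has_dir_deriv F (space_dir j) x (Fj j x)" if x: "x \<in> \<Omega>" for j x
    unfolding F
    by (rule has_dir_deriv_eq[OF has_dir_deriv_diff[OF has_dir_deriv_mult[OF d_\<phi> d_Q[OF x]]
         has_dir_deriv_add[OF has_dir_deriv_add[OF has_dir_deriv_cmult[OF d_fst]
           has_dir_deriv_cmult[OF has_dir_deriv_power2[OF d_fst]]] has_dir_deriv_cmult[OF d_fst]]]])
       (simp add: Fj_def)
  define Fjj where "Fjj = (\<lambda>j x. \<phi>2 j (snd x) * Q x + 2 * \<phi>1 j (snd x) * (c * fst x * qj j x + wi j x)
      + \<phi> (snd x) * (c * fst x * qjj j x + H j j x))"
  have d_Fj: "has_dir_deriv (Fj j) (space_dir j) x (Fjj j x)" if x: "x \<in> \<Omega>" for j x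
    unfolding Fj_def
    by (rule has_dir_deriv_eq[OF has_dir_deriv_add[OF has_dir_deriv_mult[OF d_\<phi>1 d_Q[OF x]]
         has_dir_deriv_mult[OF d_\<phi> has_dir_deriv_add[OF has_dir_deriv_mult[OF
          has_dir_deriv_cmult[OF d_fst] d_qj[OF x]] d_wi[OF x]]]]])
       (simp add: Fjj_def algebra_simps)
  have crit: "Fj j p = 0 \<and> Fjj j p \<le> 0" for j
    by (rule has_dir_deriv_second_test[OF \<Omega> p(1) max_space d_F d_Fj]) (use p in auto)
  have "has_dir_deriv (\<lambda>x. \<phi> (snd x)) time_dir p 0"
    by (rule has_dir_deriv_snd) (simp add: has_dir_deriv_def)
  moreover have "has_dir_deriv Q time_dir p (c * (a p * h p) + c * fst p * qt p + wt p)"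
    unfolding Q_def
    by (rule has_dir_deriv_eq[OF has_dir_deriv_add[OF has_dir_deriv_mult[OF
          has_dir_deriv_cmult[OF d_fst'] d_qt[OF p(1)]] d_wt[OF p(1)]]]) auto
  ultimately have "has_dir_deriv F time_dir p
      (\<phi> (snd p) * (c * (a p * h p) + c * fst p * qt p + wt p) - C1 - C2 * fst p - \<delta>)"
    unfolding F
    by (intro has_dir_deriv_eq[OF has_dir_deriv_diff[OF has_dir_deriv_mult
         has_dir_deriv_add[OF has_dir_deriv_add[OF has_dir_deriv_cmult[OF d_fst']
           has_dir_deriv_cmult[OF has_dir_deriv_power2[OF d_fst']]] has_dir_deriv_cmult[OF d_fst']]]])
       auto
  from has_dir_deriv_nonneg_at_left_max[OF this max_time]
  have "\<delta> \<le> \<phi> (snd p) * (c * (a p * h p) + c * fst p * qt p + wt p) - C1 - C2 * fst p" by simp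
  also have "\<dots> \<le> c * fst p * ((a p)\<^sup>2 * (m * (2 * h p * (\<Sum>j\<in>UNIV. (\<phi>1 j (snd p))\<^sup>2) / \<phi> (snd p)
        - h p * (\<Sum>j\<in>UNIV. \<phi>2 j (snd p)) - 2 * m * h p * (\<Sum>j\<in>UNIV. \<phi>1 j (snd p) * wi j p)
        - 3 / 2 * (m + 1) * l * \<phi> (snd p) * (h p)\<^sup>2)))
      - m * \<rho> * \<phi> (snd p) * (a p * h p) - m * a p * w p * (\<Sum>j\<in>UNIV. \<phi>2 j (snd p))
      - 2 * m * a p * (1 + m * w p) * (\<Sum>j\<in>UNIV. \<phi>1 j (snd p) * wi j p) - C1 - C2 * fst p"
    unfolding qt_def wt_def wti_def c_def h_def
    by (rule evolution_inequality[where H = "\<lambda>i j. H i j p" and W = "\<lambda>i j. W i j p" and T = "\<lambda>i. T i p"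
          and y = "\<lambda>i. wi i p" and z = "\<lambda>j. \<phi>1 j (snd p)" and zz = "\<lambda>j. \<phi>2 j (snd p)"
          and t = "fst p" and w = "w p"])
       (use m l p crit H_sym in \<open>auto simp: T_def Fj_def Fjj_def Q_def qj_def qjj_def h_def c_def a_def\<close>)
  finally show ?thesis by (simp add: c_def)
qed

text \<open>The maximum is taken over a cylinder ending at \<open>T < t1\<close>, so that a maximum
  at time \<open>T\<close> still lies in the open set \<Omega>. The annulus bounds \<open>M1\<close>
  and \<open>M3\<close> suffice because the derivatives of the cutoff vanish on the inner
  ball.\<close>

lemma log_gradient_estimate:
  fixes w :: "real \<times> (real^'n) \<Rightarrow> real" and x0 :: "real^'n" and R \<epsilon> t1 T m \<rho> l M1 M3 N :: real
  defines "\<Omega> \<equiv> {0<..<t1} \<times> ball x0 (R + \<epsilon>)"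
  defines "wi \<equiv> \<lambda>i. dir_deriv (space_dir i) w"
  defines "a \<equiv> \<lambda>p. exp ((m - 1) * w p)" and "h \<equiv> \<lambda>p. \<Sum>i\<in>UNIV. (wi i p)\<^sup>2"
  defines "L \<equiv> 8 / \<epsilon>\<^sup>2 * (real CARD('n) * \<epsilon> / (2 * R + \<epsilon>) + 8 * (R + \<epsilon>)\<^sup>2 / (2 * R + \<epsilon>)\<^sup>2)"
  defines "K \<equiv> m / 2 * (1 / l ^ 3) + 3 / 2 * (1 / l)"
  assumes R: "R > 0" "\<epsilon> > 0" and T: "0 < T" "T < t1" and m: "0 < m" "m < 1" and \<rho>: "0 < \<rho>" "\<rho> < m"
    and l: "0 < l" "l * (3 * (m + 1)) = - real CARD('n) * (m - 1)\<^sup>2 - 2 * (m - 1)" "9 * l\<^sup>2 \<le> 1 - m"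
    and w: "smooth_within ({0..t1} \<times> cball x0 (R + \<epsilon>)) w"
    and pde: "\<And>p. p \<in> \<Omega> \<Longrightarrow> dir_deriv time_dir w p
      = m * a p * ((\<Sum>j\<in>UNIV. dir_deriv (space_dir j) (wi j) p) + m * h p)"
    and N: "\<And>y. y \<in> cball x0 (R + \<epsilon>) \<Longrightarrow> \<bar>w (0, y)\<bar> \<le> N"
    and M: "0 \<le> M1" "0 \<le> M3"
    and M1: "\<And>t y. t \<in> {0..T} \<Longrightarrow> y \<in> cball x0 (R + \<epsilon>) - cball x0 R \<Longrightarrow> (a (t, y))\<^sup>2 \<le> M1"
    and M3: "\<And>t y. t \<in> {0..T} \<Longrightarrow> y \<in> cball x0 (R + \<epsilon>) - cball x0 R \<Longrightarrow>
      (\<rho> * \<bar>w (t, y)\<bar> + (m * w (t, y) + 1)\<^sup>2) * a (t, y) \<le> M3"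
    and x: "x \<in> cball x0 R"
  shows "a (T, x) * h (T, x) \<le> (N - w (T, x)) / (m * (m - \<rho>) * T) + L * M3 / (\<rho> * (m - \<rho>))
    + K * m * M1 * L\<^sup>2 * (T / 2)"
proof -
  let ?S = "{0..t1} \<times> cball x0 (R + \<epsilon>)"
  have \<Omega>: "open \<Omega>" unfolding \<Omega>_def by (intro open_Times open_greaterThanLessThan open_ball)
  have \<Omega>S: "\<Omega> \<subseteq> ?S" unfolding \<Omega>_def by auto
  have w\<Omega>: "smooth_within \<Omega> w"
    using w C_k_within_subset[OF _ \<Omega>S] by (auto simp: smooth_within_def)
  \<comment> \<open>\<open>wi\<close> is only known in the interior; \<open>w'\<close> extends it continuously to the closed cylinder.\<close>
  have "C_k_within (Suc 0) ?S w" using w by (simp only: smooth_within_def)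
  then obtain w' where w': "\<And>p. p \<in> ?S \<Longrightarrow> (w has_derivative w' p) (at p within ?S)"
    and w'_cont: "\<And>k. continuous_on ?S (\<lambda>p. w' p k)" by auto
  have w'_eq: "w' p (space_dir i) = wi i p" if "p \<in> \<Omega>" for p i
  proof -
    have "p \<in> interior ?S" using that interior_maximal[OF \<Omega>S \<Omega>] by auto
    then have "(w has_derivative w' p) (at p)"
      using w'[of p] that \<Omega>S at_within_interior[of p ?S] by auto
    from frechet_derivative_at[OF this] show ?thesis by (simp add: wi_def dir_deriv_def)
  qed
  define c where "c = m * (m - \<rho>)"
  have c: "0 < c" using m \<rho> by (simp add: c_def)
  \<comment> \<open>Since \<open>(R + \<epsilon>)^2 - R^2 = \<epsilon> (2 R + \<epsilon>)\<close>,
    this normalizes the radial variable to run from 0 to 1 across the annulus.\<close>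
  define k where "k = 1 / (\<epsilon> * (2 * R + \<epsilon>))"
  have k: "0 < k" using R by (simp add: k_def)
  have K: "0 \<le> K" using m l by (simp add: K_def)
  define s where "s = (\<lambda>x :: real^'n. max (k * ((norm (x - x0))\<^sup>2 - R\<^sup>2)) 0)"
  define \<phi>1 \<phi>2 where "\<phi>1 = (\<lambda>j x. bump1 (s x) * (2 * k * (x - x0) $ j))"
    and "\<phi>2 = (\<lambda>j x. bump2 (s x) * (2 * k * (x - x0) $ j)\<^sup>2 + bump1 (s x) * (2 * k))"
  define Ns Ds Nb where "Ns = (\<lambda>x. 4 * k\<^sup>2 * (norm (x - x0))\<^sup>2)" and "Ds = 2 * real CARD('n) * k"
    and "Nb = 4 * k\<^sup>2 * (R + \<epsilon>)\<^sup>2"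
  \<comment> \<open>The explicit constant of the theorem is recovered here: \<open>Ds\<close> is the
    Laplacian of the radial variable and \<open>Nb\<close> the maximum of its squared gradient,
    attained on the outer sphere.\<close>
  have L: "L = 4 * Ds + 16 * Nb"
  proof -
    have "8 / \<epsilon>\<^sup>2 * (n * \<epsilon> / d + 8 * r\<^sup>2 / d\<^sup>2) = 4 * (2 * n * (1 / (\<epsilon> * d))) + 16 * (4 * (1 / (\<epsilon> * d))\<^sup>2 * r\<^sup>2)"
      if "0 < d" for n d r :: real
      using that R by (simp add: field_simps power2_eq_square)
    from this[of "2 * R + \<epsilon>" "real CARD('n)" "R + \<epsilon>"] R show ?thesis
      by (simp add: L_def Ds_def Nb_def k_def)
  qed
  have "0 \<le> Ds" "0 \<le> Nb" using k by (auto simp: Ds_def Nb_def)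
  then have L0: "0 \<le> L" by (simp add: L)
  have ann: "k * ((R + \<epsilon>)\<^sup>2 - R\<^sup>2) = 1"
    using R by (simp add: k_def divide_simps) (simp add: power2_eq_square algebra_simps)
  have norm_ball: "norm (y - x0) = dist x0 y" for y by (simp add: dist_norm norm_minus_commute)
  have s_lt: "s y < 1" if "y \<in> ball x0 (R + \<epsilon>)" for y
  proof -
    have "(norm (y - x0))\<^sup>2 < (R + \<epsilon>)\<^sup>2" using that R norm_ball[of y] by (intro power_strict_mono) auto
    then have "k * ((norm (y - x0))\<^sup>2 - R\<^sup>2) < 1" using k ann by (metis diff_strict_right_mono mult_strict_left_mono)
    then show ?thesis by (simp add: s_def)
  qed
  have s_bdry: "s y = 1" if "dist x0 y = R + \<epsilon>" for y using that ann norm_ball[of y] by (simp add: s_def)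
  have s_in: "s y = 0" if "y \<in> cball x0 R" for y
  proof -
    have "(norm (y - x0))\<^sup>2 \<le> R\<^sup>2" using that R norm_ball[of y] by (intro power_mono) auto
    then show ?thesis using k by (simp add: s_def mult_le_0_iff)
  qed
  have s0: "0 \<le> s y" for y by (simp add: s_def)
  define C1 C2 where "C1 = m / \<rho> * L * M3" and "C2 = c * K * m * M1 * L\<^sup>2"
  have C: "0 \<le> C1" "0 \<le> C2" using m \<rho> L0 M c K by (auto simp: C1_def C2_def)
  \<comment> \<open>The squared gradient is a parameter: the extension \<open>h'\<close> gives
    continuity up to the boundary, hence a maximum, while \<open>h\<close> is the version that can
    be differentiated. They agree on \<Omega>.\<close>
  define F where "F = (\<lambda>g :: real \<times> (real^'n) \<Rightarrow> real. \<lambda>\<delta> p. bump (s (snd p)) * (c * fst p * (a p * g p) + w p)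
      - (C1 * fst p + C2 / 2 * (fst p)\<^sup>2 + \<delta> * fst p))"
  define h' where "h' = (\<lambda>p. \<Sum>i\<in>UNIV. (w' p (space_dir i))\<^sup>2)"
  have h': "h' p = h p" if "p \<in> \<Omega>" for p using w'_eq[OF that] by (simp add: h'_def h_def)
  have bump_cont: "continuous_on X bump" for X
    by (meson DERIV_isCont bump_deriv continuous_at_imp_continuous_on)
  have F_cont: "continuous_on ?S (F h' \<delta>)" for \<delta>
  proof -
    have "continuous_on ?S w" using w by (rule smooth_within_continuous)
    moreover from this have "continuous_on ?S a" unfolding a_def by (intro continuous_intros)
    moreover have "continuous_on ?S h'" unfolding h'_def by (intro continuous_intros w'_cont)
    moreover have "continuous_on ?S (\<lambda>p. bump (s (snd p)))"
      unfolding s_def by (intro continuous_on_compose2[OF bump_cont] continuous_intros) auto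
    ultimately show ?thesis unfolding F_def by (intro continuous_intros)
  qed
  let ?K = "{0..T} \<times> cball x0 (R + \<epsilon>)"
  have N0: "0 \<le> N" using order_trans[OF abs_ge_zero N[of x0]] R by simp
  have bump_01: "0 < bump (s y)" "bump (s y) \<le> 1" if "y \<in> ball x0 (R + \<epsilon>)" for y
    using profile_pos[of "1 - s y"] profile_le[of "1 - s y"] s_lt[OF that] s0[of y]
    by (auto simp: bump_def power_le_one less_imp_le)
  have main: "F h' \<delta> p \<le> N" if \<delta>: "\<delta> > 0" and p: "p \<in> ?K" for \<delta> p
  proof -
    have cpt: "compact ?K" "?K \<noteq> {}" using R T by (auto intro!: compact_Times)
    have KS: "?K \<subseteq> ?S" using T by auto
    have "\<exists>q\<in>?K. \<forall>p\<in>?K. F h' \<delta> p \<le> F h' \<delta> q"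
      by (rule continuous_attains_sup[OF cpt continuous_on_subset[OF F_cont KS]])
    then obtain q where q: "q \<in> ?K" "\<And>p. p \<in> ?K \<Longrightarrow> F h' \<delta> p \<le> F h' \<delta> q" by metis
    have "F h' \<delta> q \<le> N"
    proof (cases "fst q = 0 \<or> dist x0 (snd q) = R + \<epsilon>")
      case True
      then show ?thesis
      proof
        \<comment> \<open>The factor \<open>t\<close> removes the gradient term, so only the initial
          values of \<open>w\<close> have to be bounded, not their gradient.\<close>
        assume t: "fst q = 0"
        have y: "snd q \<in> cball x0 (R + \<epsilon>)" using q(1) by auto
        have "bump (s (snd q)) \<in> {0..1}"
        proof (cases "dist x0 (snd q) = R + \<epsilon>")
          case True
          then show ?thesis by (simp add: s_bdry bump_def profile_def)
        next
          case False
          then have "snd q \<in> ball x0 (R + \<epsilon>)" using y by auto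
          then show ?thesis using bump_01 less_imp_le by auto
        qed
        moreover have "\<bar>w (0, snd q)\<bar> \<le> N" by (rule N[OF y])
        ultimately have "bump (s (snd q)) * \<bar>w (0, snd q)\<bar> \<le> 1 * N"
          by (intro mult_mono) auto
        moreover have "bump (s (snd q)) * w (0, snd q) \<le> bump (s (snd q)) * \<bar>w (0, snd q)\<bar>"
          using \<open>bump (s (snd q)) \<in> {0..1}\<close> by (intro mult_left_mono) auto
        ultimately show ?thesis using t by (cases q) (simp add: F_def)
      next
        assume "dist x0 (snd q) = R + \<epsilon>"
        then have "bump (s (snd q)) = 0" by (simp add: s_bdry bump_def profile_def)
        moreover have "0 \<le> fst q" using q(1) by auto
        then have "0 \<le> C1 * fst q + C2 / 2 * (fst q)\<^sup>2 + \<delta> * fst q"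
          using C \<delta> by (intro add_nonneg_nonneg mult_nonneg_nonneg) auto
        ultimately show ?thesis using N0 by (simp add: F_def)
      qed
    next
      case False
      then have t: "0 < fst q" "fst q \<le> T" and y: "snd q \<in> ball x0 (R + \<epsilon>)"
        using q(1) by (auto simp: less_le)
      have q\<Omega>: "q \<in> \<Omega>" using t y T by (cases q) (auto simp: \<Omega>_def)
      have F_eq: "F h \<delta> p = F h' \<delta> p" if "p \<in> \<Omega>" for p using h'[OF that] by (simp add: F_def)
      have F_max: "F h \<delta> p \<le> F h \<delta> q" if "p \<in> \<Omega>" "fst p \<le> T" for p
        using that q(2)[of p] F_eq q\<Omega> by (cases p) (auto simp: \<Omega>_def)
      have max_space: "eventually (\<lambda>r. F h \<delta> (q + r *\<^sub>R space_dir j) \<le> F h \<delta> q) (nhds 0)" for j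
        using eventually_line_in_open[OF \<Omega> q\<Omega>, of "space_dir j"]
        by eventually_elim (use t in \<open>auto intro!: F_max\<close>)
      have max_time: "eventually (\<lambda>r. F h \<delta> (q + r *\<^sub>R time_dir) \<le> F h \<delta> q) (at_left 0)"
      proof -
        have "eventually (\<lambda>r. q + r *\<^sub>R time_dir \<in> \<Omega>) (at_left 0)"
          using eventually_line_in_open[OF \<Omega> q\<Omega>, of time_dir] by (simp add: eventually_nhds_conv_at eventually_at_split)
        moreover have "eventually (\<lambda>r :: real. r < 0) (at_left 0)" by (simp add: eventually_at_filter)
        ultimately show ?thesis
          by eventually_elim (use t in \<open>auto intro!: F_max\<close>)
      qed
      have cutoff: "has_dir_deriv (\<lambda>x. bump (s x)) (axis j 1) x (\<phi>1 j x)"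
        "has_dir_deriv (\<phi>1 j) (axis j 1) x (\<phi>2 j x)" for j x
        unfolding s_def \<phi>1_def \<phi>2_def by (rule cutoff_dir_deriv)+
      have "\<delta> \<le> m * (m - \<rho>) * fst q * ((a q)\<^sup>2 * (m * (2 * h q * (\<Sum>j\<in>UNIV. (\<phi>1 j (snd q))\<^sup>2) / bump (s (snd q))
        - h q * (\<Sum>j\<in>UNIV. \<phi>2 j (snd q)) - 2 * m * h q * (\<Sum>j\<in>UNIV. \<phi>1 j (snd q) * wi j q)
        - 3 / 2 * (m + 1) * l * bump (s (snd q)) * (h q)\<^sup>2)))
        - m * \<rho> * bump (s (snd q)) * (a q * h q) - m * a q * w q * (\<Sum>j\<in>UNIV. \<phi>2 j (snd q))
        - 2 * m * a q * (1 + m * w q) * (\<Sum>j\<in>UNIV. \<phi>1 j (snd q) * wi j q) - C1 - C2 * fst q"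
        unfolding F_def c_def a_def h_def wi_def
        by (rule maximum_point_inequality[where \<phi> = "\<lambda>x. bump (s x)", OF \<Omega> w\<Omega>
              pde[unfolded a_def h_def wi_def] cutoff m(1) \<rho>(2) l(2) q\<Omega> t(1) bump_01(1)[OF y]
              max_space[unfolded F_def c_def a_def h_def wi_def]
              max_time[unfolded F_def c_def a_def h_def wi_def]])
      also have "\<dots> \<le> 0"
      proof -
        define P where "P = (\<Sum>j\<in>UNIV. \<phi>1 j (snd q) * wi j q)"
        define Z where "Z = (bump1 (s (snd q)))\<^sup>2 * Ns (snd q)"
        define \<Lambda> where "\<Lambda> = bump1 (s (snd q)) * Ds + bump2 (s (snd q)) * Ns (snd q)"
        have Z: "(\<Sum>j\<in>UNIV. (\<phi>1 j (snd q))\<^sup>2) = Z"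
          unfolding \<phi>1_def Z_def Ns_def by (rule sum_cutoff_dir_deriv)
        have \<Lambda>: "(\<Sum>j\<in>UNIV. \<phi>2 j (snd q)) = \<Lambda>"
          unfolding \<phi>2_def \<Lambda>_def Ns_def Ds_def by (rule sum_cutoff_dir_deriv)
        have h0: "0 \<le> h q" unfolding h_def by (intro sum_nonneg) auto
        have a0: "0 < a q" by (simp add: a_def)
        have PZ: "P\<^sup>2 \<le> h q * Z"
          unfolding P_def h_def Z[symmetric] by (subst mult.commute) (rule Cauchy_Schwarz_ineq_sum)
        have Ns: "0 \<le> Ns (snd q)" "Ns (snd q) \<le> Nb"
          using y R norm_ball[of "snd q"] unfolding Ns_def Nb_def
          by (auto intro!: mult_left_mono power_mono)
        show ?thesis
        proof (cases "snd q \<in> cball x0 R")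
          \<comment> \<open>On the inner ball the annulus bounds say nothing, but there the cutoff
            is constantly 1 to second order and all remaining terms are nonpositive.\<close>
          case True
          then have s: "s (snd q) = 0" by (rule s_in)
          then have "Z = 0" "\<Lambda> = 0" by (simp_all add: Z_def \<Lambda>_def bump_at_0)
          moreover from this have "P = 0" using PZ by simp
          moreover have "0 \<le> c * fst q * ((a q)\<^sup>2 * (m * (3 / 2 * (m + 1) * l * (h q)\<^sup>2)))"
            using c t m l by auto
          moreover have "0 \<le> m * \<rho> * (a q * h q)" "0 \<le> C2 * fst q" using m \<rho> a0 h0 C t by auto
          ultimately show ?thesis using C(1) unfolding Z \<Lambda> P_def[symmetric] s c_def[symmetric]
            by (simp add: bump_at_0)
        next
          case False
          have q_ann: "fst q \<in> {0..T}" "snd q \<in> cball x0 (R + \<epsilon>) - cball x0 R"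
            using False t y by auto
          show ?thesis
            unfolding Z \<Lambda> P_def[symmetric] C1_def C2_def c_def[symmetric]
          proof (rule localization_source_nonpos)
            show "Z \<le> bump (s (snd q)) * L" unfolding Z_def
              by (rule bump_gradient_le[OF s0 s_lt[OF y] Ns \<open>0 \<le> Ds\<close> L])
            show "\<bar>\<Lambda>\<bar> \<le> L" unfolding \<Lambda>_def
              by (rule bump_laplacian_le[OF s0 s_lt[OF y] Ns \<open>0 \<le> Ds\<close> L])
            show "2 * h q * Z / bump (s (snd q)) - h q * \<Lambda> - 2 * m * h q * P
              - 3 / 2 * (m + 1) * l * bump (s (snd q)) * (h q)\<^sup>2 \<le> K * L\<^sup>2"
              unfolding Z_def \<Lambda>_def K_def
              by (rule bump_absorption[OF s0 s_lt[OF y] Ns \<open>0 \<le> Ds\<close> L h0 PZ[unfolded Z_def] m l(1,3)])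
            show "(a q)\<^sup>2 \<le> M1" using M1[OF q_ann] by simp
            show "(\<rho> * \<bar>w q\<bar> + (m * w q + 1)\<^sup>2) * a q \<le> M3" using M3[OF q_ann] by simp
          qed (use \<rho> a0 h0 t K L0 c PZ bump_01[OF y] in auto)
        qed
      qed
      finally show ?thesis using \<delta> by simp
    qed
    then show ?thesis using q(2)[OF p] by simp
  qed
  have Tx: "(T, x) \<in> \<Omega>" "(T, x) \<in> ?K" using T R x by (auto simp: \<Omega>_def)
  have "c * T * (a (T, x) * h (T, x)) + w (T, x) - (C1 * T + C2 / 2 * T\<^sup>2) \<le> N"
  proof (rule field_le_epsilon)
    fix e :: real assume "e > 0"
    \<comment> \<open>The penalty \<open>e / T\<close> costs exactly \<open>e\<close> at time
      \<open>T\<close>.\<close>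
    then show "c * T * (a (T, x) * h (T, x)) + w (T, x) - (C1 * T + C2 / 2 * T\<^sup>2) \<le> N + e"
      using main[of "e / T" "(T, x)"] Tx T h'[OF Tx(1)] s_in[OF x] by (simp add: F_def bump_at_0)
  qed
  then have "c * T * (a (T, x) * h (T, x)) \<le> N - w (T, x) + C1 * T + C2 / 2 * T\<^sup>2" by simp
  then have "a (T, x) * h (T, x) \<le> (N - w (T, x) + C1 * T + C2 / 2 * T\<^sup>2) / (c * T)"
    using c T by (simp add: pos_le_divide_eq mult.commute)
  also have "\<dots> = (N - w (T, x)) / (c * T) + C1 / c + C2 / c * (T / 2)"
    using c T by (simp add: field_simps power2_eq_square)
  also have "C1 / c = L * M3 / (\<rho> * (m - \<rho>))" using m by (simp add: C1_def c_def)
  also have "C2 / c = K * m * M1 * L\<^sup>2" using c by (simp add: C2_def)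
  finally show ?thesis by (simp add: c_def)
qed

section \<open>The porous medium equation\<close>

text \<open>At interior points the derivative within the ball is the ordinary one. Agreement of
  \<open>G\<close> with a slice of \<open>F\<close> is asked only on the open ball, so that the
  lemma can be iterated with \<open>G\<close> itself a partial derivative within the closed
  ball.\<close>

lemma partial_within_slice:
  fixes F :: "real \<times> (real^'n) \<Rightarrow> real" and G :: "real^'n \<Rightarrow> real"
  assumes "x \<in> ball x0 r" "\<And>y. y \<in> ball x0 r \<Longrightarrow> G y = F (t, y)"
    and F: "(F has_derivative F') (at (t, x))"
  shows "partial_within (cball x0 r) i G x = F' (space_dir i)"
proof -
  have "((\<lambda>y. F (t, y)) has_derivative (\<lambda>k. F' (0, k))) (at x)"
    by (rule has_derivative_compose[where g = F and f = "\<lambda>y. (t, y)" and s = UNIV, OF _ F])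
       (intro has_derivative_Pair has_derivative_const has_derivative_ident)
  then have "(G has_derivative (\<lambda>k. F' (0, k))) (at x)"
    by (rule has_derivative_transform_within_open[OF _ open_ball assms(1)]) (rule assms(2)[symmetric])
  then have "frechet_derivative G (at x) = (\<lambda>k. F' (0, k))" by (rule frechet_derivative_at[symmetric])
  moreover have "at x within cball x0 r = at x"
    using assms(1) interior_cball[of x0 r] by (intro at_within_interior) simp
  ultimately show ?thesis by (simp add: partial_within_def space_dir_def)
qed

text \<open>The set where a continuous function exceeds its essential bound is open in the ball and
  null, hence empty; continuity carries the bound to the sphere.\<close>

lemma abs_le_ess_sup_norm:
  fixes f :: "real^'n \<Rightarrow> real"
  assumes f: "continuous_on (cball x0 r) f" and r: "r > 0" and y: "y \<in> cball x0 r"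
  shows "\<bar>f y\<bar> \<le> ess_sup_norm (\<lambda>y. indicator (cball x0 r) y * f y)"
proof -
  define g where "g = (\<lambda>y. indicator (cball x0 r) y * f y)"
  have g_meas: "g \<in> borel_measurable borel"
    using borel_measurable_continuous_on_indicator[OF _ f] by (simp add: g_def)
  then have meas: "(\<lambda>x. ereal \<bar>g x\<bar>) \<in> borel_measurable lborel" by simp
  obtain B where B: "\<And>x. x \<in> cball x0 r \<Longrightarrow> \<bar>f x\<bar> \<le> B"
    using compact_imp_bounded[OF compact_continuous_image[OF f compact_cball]]
    unfolding bounded_iff by (metis image_eqI real_norm_def)
  have B0: "0 \<le> B" using B[of x0] r order_trans[OF abs_ge_zero] by simp
  let ?e = "esssup lborel (\<lambda>x. ereal \<bar>g x\<bar>)"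
  have "\<bar>g x\<bar> \<le> B" for x using B[of x] B0 by (simp add: g_def indicator_def)
  then have "?e \<le> ereal B" by (intro esssup_I meas AE_I2) auto
  moreover have ae: "AE x in lborel. ereal \<bar>g x\<bar> \<le> ?e" by (rule esssup_AE)
  \<comment> \<open>Together with the upper bound \<open>B\<close> this makes the essential supremum
    finite, so the default value 0 of \<open>real_of_ereal\<close> at infinities does not interfere.
    A point satisfying the almost-everywhere bound exists because Lebesgue measure is not
    zero.\<close>
  moreover have "0 \<le> ?e"
  proof -
    have "ae_filter (lborel :: (real^'n) measure) \<noteq> bot" by (simp add: ae_filter_eq_bot_iff)
    from eventually_happens'[OF this ae] obtain x where "ereal \<bar>g x\<bar> \<le> ?e" by blast
    moreover have "0 \<le> ereal \<bar>g x\<bar>" by simp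
    ultimately show ?thesis by (rule order_trans[rotated])
  qed
  ultimately obtain E where E: "?e = ereal E" by (cases ?e) auto
  have "AE x in lborel. \<bar>g x\<bar> \<le> E" using ae by (simp add: E)
  then obtain N where N: "N \<in> null_sets lborel" "{x. \<not> \<bar>g x\<bar> \<le> E} \<subseteq> N"
    unfolding eventually_ae_filter by auto
  define V where "V = ball x0 r \<inter> (\<lambda>x. \<bar>f x\<bar>) -` {E<..}"
  have "continuous_on (ball x0 r) (\<lambda>x. \<bar>f x\<bar>)"
    by (intro continuous_on_rabs continuous_on_subset[OF f] ball_subset_cball)
  then have V: "open V" unfolding V_def
    by (intro continuous_open_preimage) auto
  have "V \<subseteq> N" using N(2) by (auto simp: V_def g_def indicator_def)
  then have "V \<in> null_sets lborel" using N(1) V by (intro null_sets_subset[OF N(1)]) auto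
  then have "V \<in> null_sets lebesgue" by (rule null_sets_completionI)
  then have "V = {}" using open_not_negligible[OF V] by (auto simp: negligible_iff_null_sets)
  then have "\<And>x. x \<in> ball x0 r \<Longrightarrow> \<bar>f x\<bar> \<le> E" by (auto simp: V_def not_less)
  moreover have "closure (ball x0 r) = cball x0 r" using r by simp
  ultimately have "\<bar>f y\<bar> \<le> E"
    using continuous_le_on_closure[of "ball x0 r" "\<lambda>x. \<bar>f x\<bar>" y E] continuous_on_rabs[OF f] y
    by simp
  then show ?thesis by (simp add: ess_sup_norm_def g_def[symmetric] E)
qed

text \<open>With \<open>u = exp w\<close> the Laplacian of \<open>u^m = exp (m w)\<close> is
  \<open>m exp (m w)\<close> times the bracket, and passing from \<open>u\<close> to
  \<open>ln u\<close> divides by \<open>exp w\<close>.\<close>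

lemma log_equation:
  fixes w :: "real \<times> (real^'n) \<Rightarrow> real" and u :: "real \<Rightarrow> real^'n \<Rightarrow> real"
  defines "wi \<equiv> \<lambda>i. dir_deriv (space_dir i) w"
  assumes \<Omega>: "open \<Omega>" "smooth_within \<Omega> w" "\<And>y. y \<in> ball x0 r \<Longrightarrow> (t, y) \<in> \<Omega>"
    and x: "x \<in> ball x0 r"
    and u: "\<And>p. p \<in> \<Omega> \<Longrightarrow> w p = ln (u (fst p) (snd p)) \<and> 0 < u (fst p) (snd p)"
    and sol: "((\<lambda>s. u s x) has_real_derivative
      laplacian_within (cball x0 r) (\<lambda>y. u t y powr m) x) (at t)"
  shows "dir_deriv time_dir w (t, x) = m * exp ((m - 1) * w (t, x)) *
    ((\<Sum>j\<in>UNIV. dir_deriv (space_dir j) (wi j) (t, x)) + m * (\<Sum>i\<in>UNIV. (wi i (t, x))\<^sup>2))"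
proof -
  note deriv = smooth_within_has_derivative[OF \<Omega>(1)]
  have wi_smooth: "smooth_within \<Omega> (wi i)" for i
    unfolding wi_def by (rule smooth_within_dir_deriv[OF \<Omega>(1,2)])
  have u_exp: "u t y = exp (w (t, y))" "u t y powr m = exp (m * w (t, y))" if "y \<in> ball x0 r" for y
    using u[OF \<Omega>(3)[OF that]] by (auto simp: powr_def)
  have p1: "partial_within (cball x0 r) i (\<lambda>y. u t y powr m) y = m * exp (m * w (t, y)) * wi i (t, y)"
    if y: "y \<in> ball x0 r" for i y
  proof -
    have "((\<lambda>p. exp (m * w p)) has_derivative (\<lambda>k. exp (m * w (t, y)) * (m * dir_deriv k w (t, y)))) (at (t, y))"
      by (rule derivative_eq_intros deriv[OF \<Omega>(2) \<Omega>(3)[OF y]] refl | simp add: fun_eq_iff algebra_simps)+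
    from partial_within_slice[OF y _ this] show ?thesis using u_exp by (simp add: wi_def)
  qed
  have p2: "partial_within (cball x0 r) i (partial_within (cball x0 r) i (\<lambda>y. u t y powr m)) x
      = m * exp (m * w (t, x)) * (dir_deriv (space_dir i) (wi i) (t, x) + m * (wi i (t, x))\<^sup>2)" for i
  proof -
    note tx = \<Omega>(3)[OF x]
    have "((\<lambda>p. m * exp (m * w p) * wi i p) has_derivative
        (\<lambda>k. m * exp (m * w (t, x)) * dir_deriv k (wi i) (t, x)
          + m * (exp (m * w (t, x)) * (m * dir_deriv k w (t, x))) * wi i (t, x))) (at (t, x))"
      by (rule derivative_eq_intros deriv[OF \<Omega>(2) tx] deriv[OF wi_smooth tx] refl | simp add: fun_eq_iff algebra_simps)+
    from partial_within_slice[OF x _ this] p1 show ?thesis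
      by (simp add: wi_def power2_eq_square algebra_simps)
  qed
  let ?X = "(\<Sum>j\<in>UNIV. dir_deriv (space_dir j) (wi j) (t, x)) + m * (\<Sum>i\<in>UNIV. (wi i (t, x))\<^sup>2)"
  have lap: "laplacian_within (cball x0 r) (\<lambda>y. u t y powr m) x = m * exp (m * w (t, x)) * ?X"
    unfolding laplacian_within_def p2 by (simp add: sum_distrib_left[symmetric] sum.distrib)
  have pos: "0 < u t x" using u[OF \<Omega>(3)[OF x]] by simp
  have "((\<lambda>s. ln (u s x)) has_real_derivative 1 / u t x * (m * exp (m * w (t, x)) * ?X)) (at t)"
    using sol pos unfolding lap by (auto intro!: DERIV_chain2[of ln] derivative_eq_intros)
  then have "has_dir_deriv (\<lambda>p. ln (u (fst p) (snd p))) time_dir (t, x)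
      (1 / u t x * (m * exp (m * w (t, x)) * ?X))"
    unfolding has_dir_deriv_def using DERIV_shift[of "\<lambda>s. ln (u s x)" _ 0 t]
    by (simp add: time_dir_def add.commute)
  then have "has_dir_deriv w time_dir (t, x) (1 / u t x * (m * exp (m * w (t, x)) * ?X))"
    using has_dir_deriv_cong[OF \<Omega>(1) \<Omega>(3)[OF x], of w "\<lambda>p. ln (u (fst p) (snd p))"] u by simp
  from has_dir_deriv_unique[OF smooth_has_dir_deriv[OF \<Omega>(1,2) \<Omega>(3)[OF x]] this]
  have "dir_deriv time_dir w (t, x) = 1 / u t x * (m * exp (m * w (t, x)) * ?X)" .
  also have "\<dots> = m * exp ((m - 1) * w (t, x)) * ?X"
    by (simp add: u_exp(1)[OF x] left_diff_distrib exp_diff)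
  finally show ?thesis .
qed

text \<open>Since \<open>(m - 1) v = a\<close> with \<open>a = exp ((m - 1) w)\<close>, the gradient
  of \<open>v\<close> is \<open>a\<close> times that of \<open>w\<close>, and one factor
  \<open>a\<close> cancels in the quotient.\<close>

lemma gradient_quotient_eq:
  fixes w :: "real \<times> (real^'n) \<Rightarrow> real" and v :: "real^'n \<Rightarrow> real"
  assumes \<Omega>: "open \<Omega>" "smooth_within \<Omega> w" "\<And>y. y \<in> ball x0 r \<Longrightarrow> (t, y) \<in> \<Omega>"
    and x: "x \<in> ball x0 r" and "m < 1"
    and v: "\<And>y. y \<in> ball x0 r \<Longrightarrow> v y = exp ((m - 1) * w (t, y)) / (m - 1)"
  shows "norm (gradient_within (cball x0 r) v x)^2 / ((m - 1) * v x)
    = exp ((m - 1) * w (t, x)) * (\<Sum>i\<in>UNIV. (dir_deriv (space_dir i) w (t, x))\<^sup>2)"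
proof -
  let ?e = "exp ((m - 1) * w (t, x))"
  have "partial_within (cball x0 r) i v x = ?e * dir_deriv (space_dir i) w (t, x)" for i
  proof -
    have "((\<lambda>p. exp ((m - 1) * w p) / (m - 1)) has_derivative
        (\<lambda>k. ?e * ((m - 1) * dir_deriv k w (t, x)) / (m - 1))) (at (t, x))"
      by (rule derivative_eq_intros smooth_within_has_derivative[OF \<Omega>(1,2) \<Omega>(3)[OF x]] refl
          | use \<open>m < 1\<close> in \<open>simp add: fun_eq_iff field_simps\<close>)+
    from partial_within_slice[OF x _ this, of v] v \<open>m < 1\<close> show ?thesis by simp
  qed
  then have "norm (gradient_within (cball x0 r) v x)^2 = ?e\<^sup>2 * (\<Sum>i\<in>UNIV. (dir_deriv (space_dir i) w (t, x))\<^sup>2)"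
    unfolding power2_norm_eq_inner inner_vec_def gradient_within_def
    by (simp add: sum_distrib_left power2_eq_square mult_ac)
  then show ?thesis using v[OF x] \<open>m < 1\<close> by (simp add: power2_eq_square)
qed

theorem corollary2:
  fixes u :: "real \<Rightarrow> real^'n \<Rightarrow> real"
    and v :: "real \<Rightarrow> real^'n \<Rightarrow> real"
    and x0 :: "real^'n"
    and R \<epsilon> t1 m :: real
  assumes "R > 0" "\<epsilon> > 0" "t1 > 0"
    and "1 - 2 / real CARD('n) < m" "m < 1" "m > 0"
    and u_smooth: "smooth_within ({0..t1} \<times> cball x0 (R + \<epsilon>)) (\<lambda>(t, x). u t x)"
    and u_pos: "\<And>t x. t \<in> {0..t1} \<Longrightarrow> x \<in> cball x0 (R + \<epsilon>) \<Longrightarrow> u t x > 0"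
    and u_bounded: "bounded ((\<lambda>(t, x). u t x) ` ({0..t1} \<times> cball x0 (R + \<epsilon>)))"
    and u_solution: "\<And>t x. t \<in> {0<..<t1} \<Longrightarrow> x \<in> cball x0 (R + \<epsilon>) \<Longrightarrow>
       ((\<lambda>s. u s x) has_real_derivative
          laplacian_within (cball x0 (R + \<epsilon>)) (\<lambda>y. u t y powr m) x) (at t)"
    and v_eq: "\<And>t x. t \<in> {0..t1} \<Longrightarrow> x \<in> cball x0 (R + \<epsilon>) \<Longrightarrow>
       v t x = u t x powr (m - 1) / (m - 1)"
  shows "\<forall>\<rho>\<in>{0<..<m}. \<forall>T\<in>{0<..<t1}. \<forall>x\<in>cball x0 R.
    (let L = 8 / \<epsilon>^2 * (real CARD('n) * \<epsilon> / (2 * R + \<epsilon>) + 8 * (R + \<epsilon>)^2 / (2 * R + \<epsilon>)^2);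
         l = (- real CARD('n) * (m - 1)^2 - 2 * (m - 1)) / (3 * (m + 1));
         A = cball x0 (R + \<epsilon>) - cball x0 R;
         M1 = (SUP (t, y)\<in>{0..T} \<times> A. u t y powr (2 * m - 2));
         M3 = (SUP (t, y)\<in>{0..T} \<times> A.
                 (\<rho> * \<bar>ln (u t y)\<bar> + (m * ln (u t y) + 1)^2) * u t y powr (m - 1))
     in norm (gradient_within (cball x0 (R + \<epsilon>)) (v T) x)^2 / ((m - 1) * v T x)
        \<le> (ess_sup_norm (\<lambda>y. indicator (cball x0 (R + \<epsilon>)) y * ln (u 0 y)) - ln (u T x))
             / (m * (m - \<rho>) * T)
          + L * M3 / (\<rho> * (m - \<rho>))
          + (m / 2 * (1 / l^3) + 3 / 2 * (1 / l)) * m * M1 * L^2 * (T / 2))"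
proof (intro ballI)
  fix \<rho> T x assume \<rho>: "\<rho> \<in> {0<..<m}" and T: "T \<in> {0<..<t1}" and x: "x \<in> cball x0 R"
  let ?S = "{0..t1} \<times> cball x0 (R + \<epsilon>)"
  define A where "A = cball x0 (R + \<epsilon>) - cball x0 R"
  define w where "w = (\<lambda>p. ln (u (fst p) (snd p)))"
  define \<Omega> where "\<Omega> = {0<..<t1} \<times> ball x0 (R + \<epsilon>)"
  have \<Omega>: "open \<Omega>" "\<Omega> \<subseteq> ?S"
    unfolding \<Omega>_def by (auto intro!: open_Times)
  have "smooth_within ?S (\<lambda>p. ln (case p of (t, x) \<Rightarrow> u t x))"
    by (rule smooth_within_ln[OF _ u_smooth]) (auto simp: u_pos)
  then have w: "smooth_within ?S w" by (simp add: w_def case_prod_beta)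
  then have w\<Omega>: "smooth_within \<Omega> w"
    using C_k_within_subset[OF _ \<Omega>(2)] by (auto simp: smooth_within_def)
  have w_cont: "continuous_on ?S w" using w by (rule smooth_within_continuous)
  have w_eq: "w (t, y) = ln (u t y)" for t y by (simp add: w_def)
  have powr_eq: "u t y powr b = exp (b * w (t, y))" if "t \<in> {0..t1}" "y \<in> cball x0 (R + \<epsilon>)" for t y b
    using u_pos[OF that] by (simp add: w_eq powr_def)
  have slice: "(t, y) \<in> \<Omega>" if "t \<in> {0<..<t1}" "y \<in> ball x0 (R + \<epsilon>)" for t y
    using that by (simp add: \<Omega>_def)
  define l where "l = (- real CARD('n) * (m - 1)^2 - 2 * (m - 1)) / (3 * (m + 1))"
  have l_eq: "l * (3 * (m + 1)) = - real CARD('n) * (m - 1)\<^sup>2 - 2 * (m - 1)"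
    using \<open>0 < m\<close> by (simp add: l_def)
  have n: "1 \<le> real CARD('n)" by (simp add: Suc_leI)
  \<comment> \<open>The numerator of \<open>l\<close> is \<open>(1 - m) (2 - n (1 - m))\<close>,
    whose second factor is positive exactly when \<open>m > 1 - 2 / n\<close>.\<close>
  have l_pos: "0 < l"
  proof -
    have "real CARD('n) * (1 - m) < 2" using assms(4) n by (simp add: field_simps)
    then have "0 < (1 - m) * (2 - real CARD('n) * (1 - m))" using \<open>m < 1\<close> by simp
    then show ?thesis using \<open>0 < m\<close>
      unfolding l_def by (intro divide_pos_pos) (auto simp: power2_eq_square algebra_simps)
  qed
  \<comment> \<open>The numerator decreases in \<open>n\<close> and equals
    \<open>(1 - m) (1 + m)\<close> for \<open>n = 1\<close>, so \<open>3 l \<le> 1 - m\<close>;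
    squaring a number in the unit interval only decreases it.\<close>
  have l_le: "9 * l\<^sup>2 \<le> 1 - m"
  proof -
    have "1 * (m - 1)\<^sup>2 \<le> real CARD('n) * (m - 1)\<^sup>2" using n by (rule mult_right_mono) simp
    then have "l * (3 * (m + 1)) \<le> (1 - m) / 3 * (3 * (m + 1))"
      unfolding l_eq by (simp add: power2_eq_square field_simps)
    then have "3 * l \<le> 1 - m" using \<open>0 < m\<close> by (simp only: mult_le_cancel_right) auto
    then have "(3 * l)\<^sup>2 \<le> (1 - m)\<^sup>2" using l_pos by (intro power_mono) auto
    also have "\<dots> \<le> (1 - m) ^ 1" using assms(5,6) by (intro power_decreasing) auto
    finally show ?thesis by (simp add: power_mult_distrib)
  qed
  define M1 where "M1 = (SUP (t, y)\<in>{0..T} \<times> A. u t y powr (2 * m - 2))"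
  define M3 where "M3 = (SUP (t, y)\<in>{0..T} \<times> A.
                 (\<rho> * \<bar>ln (u t y)\<bar> + (m * ln (u t y) + 1)^2) * u t y powr (m - 1))"
  have TA: "{0..T} \<times> A \<subseteq> ?S" using T by (auto simp: A_def)
  \<comment> \<open>The annulus is not closed, so boundedness above, without which a real
    \<open>SUP\<close> bounds nothing, is taken from the compact cylinder containing it.\<close>
  have le_SUP: "G (t, y) \<le> (SUP p\<in>{0..T} \<times> A. G p)"
    if "continuous_on ?S G" "(t, y) \<in> {0..T} \<times> A" for G :: "real \<times> (real^'n) \<Rightarrow> real" and t y
  proof -
    have "compact (G ` ?S)" using that(1) by (intro compact_continuous_image compact_Times) auto
    then have "bdd_above (G ` ({0..T} \<times> A))"
      using TA by (meson bdd_above_mono bounded_imp_bdd_above compact_imp_bounded image_mono)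
    then show ?thesis using that(2) by (intro cSUP_upper)
  qed
  have M1_eq: "M1 = (SUP p\<in>{0..T} \<times> A. (exp ((m - 1) * w p))\<^sup>2)"
    unfolding M1_def
  proof (intro SUP_cong refl, clarify)
    fix t y assume "t \<in> {0..T}" "y \<in> A"
    then have "t \<in> {0..t1}" "y \<in> cball x0 (R + \<epsilon>)" using T by (auto simp: A_def)
    then show "u t y powr (2 * m - 2) = (exp ((m - 1) * w (t, y)))\<^sup>2"
      by (simp add: powr_eq exp_double[symmetric] algebra_simps)
  qed
  have M3_eq: "M3 = (SUP p\<in>{0..T} \<times> A. (\<rho> * \<bar>w p\<bar> + (m * w p + 1)\<^sup>2) * exp ((m - 1) * w p))"
    unfolding M3_def
  proof (intro SUP_cong refl, clarify)
    fix t y assume "t \<in> {0..T}" "y \<in> A"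
    then have "t \<in> {0..t1}" "y \<in> cball x0 (R + \<epsilon>)" using T by (auto simp: A_def)
    then show "(\<rho> * \<bar>ln (u t y)\<bar> + (m * ln (u t y) + 1)^2) * u t y powr (m - 1)
      = (\<rho> * \<bar>w (t, y)\<bar> + (m * w (t, y) + 1)\<^sup>2) * exp ((m - 1) * w (t, y))"
      by (simp add: powr_eq w_eq[symmetric])
  qed
  have M1: "(exp ((m - 1) * w (t, y)))\<^sup>2 \<le> M1" if "t \<in> {0..T}" "y \<in> A" for t y
    unfolding M1_eq using that by (intro le_SUP continuous_intros w_cont) auto
  have M3: "(\<rho> * \<bar>w (t, y)\<bar> + (m * w (t, y) + 1)\<^sup>2) * exp ((m - 1) * w (t, y)) \<le> M3"
    if "t \<in> {0..T}" "y \<in> A" for t y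
    unfolding M3_eq using that by (intro le_SUP continuous_intros w_cont) auto
  \<comment> \<open>A point of the outer sphere shows that the annulus is nonempty, so the two
    suprema dominate a nonnegative value.\<close>
  obtain y0 where y0: "y0 \<in> A"
  proof
    show "x0 + (R + \<epsilon>) *\<^sub>R axis undefined 1 \<in> A" using assms(1,2) by (simp add: A_def dist_norm)
  qed
  have M0: "0 \<le> M1" "0 \<le> M3"
    using order_trans[OF _ M1[of 0 y0], of 0] order_trans[OF _ M3[of 0 y0], of 0] T y0 \<rho> by auto
  have N: "\<bar>w (0, y)\<bar> \<le> ess_sup_norm (\<lambda>y. indicator (cball x0 (R + \<epsilon>)) y * ln (u 0 y))"
    if "y \<in> cball x0 (R + \<epsilon>)" for y
  proof -
    have "continuous_on (cball x0 (R + \<epsilon>)) (\<lambda>y. w (0, y))"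
      using assms(3) by (intro continuous_on_compose2[OF w_cont] continuous_intros) auto
    from abs_le_ess_sup_norm[OF this _ that] show ?thesis using assms(1,2) by (simp add: w_eq)
  qed
  have pde: "dir_deriv time_dir w p = m * exp ((m - 1) * w p) *
      ((\<Sum>j\<in>UNIV. dir_deriv (space_dir j) (dir_deriv (space_dir j) w) p)
        + m * (\<Sum>i\<in>UNIV. (dir_deriv (space_dir i) w p)\<^sup>2))" if p: "p \<in> \<Omega>" for p
  proof -
    obtain t y where ty: "p = (t, y)" "t \<in> {0<..<t1}" "y \<in> ball x0 (R + \<epsilon>)"
      using p by (auto simp: \<Omega>_def)
    have u: "w p = ln (u (fst p) (snd p)) \<and> 0 < u (fst p) (snd p)" if "p \<in> \<Omega>" for p
      using that \<Omega>(2) u_pos by (auto simp: w_def)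
    show ?thesis unfolding ty(1)
      by (rule log_equation[OF \<Omega>(1) w\<Omega> slice[OF ty(2)] ty(3) u u_solution[OF ty(2)]])
         (use ty(3) in auto)
  qed
  have x': "x \<in> ball x0 (R + \<epsilon>)" using x assms(2) by auto
  have "norm (gradient_within (cball x0 (R + \<epsilon>)) (v T) x)^2 / ((m - 1) * v T x)
    = exp ((m - 1) * w (T, x)) * (\<Sum>i\<in>UNIV. (dir_deriv (space_dir i) w (T, x))\<^sup>2)"
    by (rule gradient_quotient_eq[OF \<Omega>(1) w\<Omega> slice[OF T] x' \<open>m < 1\<close>])
       (use T in \<open>auto simp: v_eq powr_eq\<close>)
  also have "\<dots> \<le> (ess_sup_norm (\<lambda>y. indicator (cball x0 (R + \<epsilon>)) y * ln (u 0 y)) - w (T, x)) / (m * (m - \<rho>) * T)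
      + (8 / \<epsilon>\<^sup>2 * (real CARD('n) * \<epsilon> / (2 * R + \<epsilon>) + 8 * (R + \<epsilon>)\<^sup>2 / (2 * R + \<epsilon>)\<^sup>2)) * M3 / (\<rho> * (m - \<rho>))
      + (m / 2 * (1 / l ^ 3) + 3 / 2 * (1 / l)) * m * M1
        * (8 / \<epsilon>\<^sup>2 * (real CARD('n) * \<epsilon> / (2 * R + \<epsilon>) + 8 * (R + \<epsilon>)\<^sup>2 / (2 * R + \<epsilon>)\<^sup>2))\<^sup>2 * (T / 2)"
    by (rule log_gradient_estimate[OF assms(1,2) _ _ \<open>0 < m\<close> \<open>m < 1\<close> _ _ l_pos l_eq l_le w
          pde[unfolded \<Omega>_def] N M0 M1[unfolded A_def] M3[unfolded A_def] x])
       (use T \<rho> in auto)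
  finally show "(let L = 8 / \<epsilon>^2 * (real CARD('n) * \<epsilon> / (2 * R + \<epsilon>) + 8 * (R + \<epsilon>)^2 / (2 * R + \<epsilon>)^2);
         l = (- real CARD('n) * (m - 1)^2 - 2 * (m - 1)) / (3 * (m + 1));
         A = cball x0 (R + \<epsilon>) - cball x0 R;
         M1 = (SUP (t, y)\<in>{0..T} \<times> A. u t y powr (2 * m - 2));
         M3 = (SUP (t, y)\<in>{0..T} \<times> A.
                 (\<rho> * \<bar>ln (u t y)\<bar> + (m * ln (u t y) + 1)^2) * u t y powr (m - 1))
     in norm (gradient_within (cball x0 (R + \<epsilon>)) (v T) x)^2 / ((m - 1) * v T x)
        \<le> (ess_sup_norm (\<lambda>y. indicator (cball x0 (R + \<epsilon>)) y * ln (u 0 y)) - ln (u T x))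
             / (m * (m - \<rho>) * T)
          + L * M3 / (\<rho> * (m - \<rho>))
          + (m / 2 * (1 / l^3) + 3 / 2 * (1 / l)) * m * M1 * L^2 * (T / 2))"
    unfolding Let_def A_def[symmetric] M1_def[symmetric] M3_def[symmetric] l_def[symmetric] w_eq .
qed

end
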